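(* Let $\eta^{(\varepsilon)}(t)$, $\varepsilon\in(0,1]$, be semi-Markov processes on $\mathbb{X}=\{1,\dots,N\}$ as in the context, satisfying conditions A, B, C, D, E of the context for some $\varepsilon_0\in(0,1]$ and transition sets $\mathbb{Y}_i$. Fix $r\in\mathbb{X}$, assume $\mathsf P\{\eta^{(\varepsilon)}_0=r\}=0$, and let $_r\eta^{(\varepsilon)}(t)$ be the reduced semi-Markov process on $_r\mathbb{X}=\mathbb{X}\setminus\{r\}$. Then conditions A, B, C, D, E hold for the processes $_r\eta^{(\varepsilon)}(t)$ (with transition probabilities $_rp_{ij}(\varepsilon)$ and expectations $_re_{ij}(\varepsilon)$ in place of $p_{ij}(\varepsilon)$, $e_{ij}(\varepsilon)$), with the same parameter $\varepsilon_0$ and transition sets $_r\mathbb{Y}_i=\mathbb{Y}^-_{ir}\cup\mathbb{Y}^+_{ir}$, $i\in{}_r\mathbb{X}$; in particular, for every $j\in{}_r\mathbb{Y}_i$, $_re_{ij}(\varepsilon)$ admits a pivotal $(_rm^-_{ij},{}_rm^+_{ij})$-expansion on $(0,\varepsilon_0]$ with positive leading coefficient.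
   Context: A $(h,k)$-expansion of $A$ on $(0,\varepsilon_0]$: $A(\varepsilon)=\sum_{l=h}^k a_l\varepsilon^l+o_A(\varepsilon^k)$ with integers $h\le k$, real $a_l$, $o_A(\varepsilon^k)/\varepsilon^k\to0$; pivotal means $a_h\neq0$. Setting: for $\varepsilon\in(0,1]$, $(\eta^{(\varepsilon)}_n,\kappa^{(\varepsilon)}_n)$, $n\ge0$, is a homogeneous Markov chain on $\mathbb{X}\times[0,\infty)$, $\kappa^{(\varepsilon)}_0=0$, with transition probabilities $Q^{(\varepsilon)}_{ij}(t)=\mathsf P\{\eta^{(\varepsilon)}_1=j,\kappa^{(\varepsilon)}_1\le t\mid\eta^{(\varepsilon)}_0=i,\kappa^{(\varepsilon)}_0=s\}$ not depending on $s$; $p_{ij}(\varepsilon)=Q^{(\varepsilon)}_{ij}(\infty)$ (stochastic matrix); $e_{ij}(\varepsilon)=\int_0^\infty t\,Q^{(\varepsilon)}_{ij}(dt)$; $\eta^{(\varepsilon)}(t)=\eta^{(\varepsilon)}_{\nu^{(\varepsilon)}(t)}$, $\nu^{(\varepsilon)}(t)=\max\{n\ge0:\kappa^{(\varepsilon)}_1+\dots+\kappa^{(\varepsilon)}_n\le t\}$. Conditions: A: there exist $\mathbb{Y}_i\subseteq\mathbb{X}$ and $\varepsilon_0\in(0,1]$ with, for $\varepsilon\in(0,\varepsilon_0]$, (a) $p_{ij}(\varepsilon)>0$, $j\in\mathbb{Y}_i$; (b) $p_{ij}(\varepsilon)=0$, $j\notin\mathbb{Y}_i$; (c) for all $i,j$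 there exist $n\ge1$, $i=l_0,\dots,l_n=j$ with $l_{k+1}\in\mathbb{Y}_{l_k}$. B: $Q^{(\varepsilon)}_{ij}(0)=0$. C: $e_{ij}(\varepsilon)<\infty$. D: for $j\in\mathbb{Y}_i$, $p_{ij}(\varepsilon)=\sum_{l=l^-_{ij}}^{l^+_{ij}}a_{ij}[l]\varepsilon^l+o_{ij}(\varepsilon^{l^+_{ij}})$ on $(0,\varepsilon_0]$ with integers $0\le l^-_{ij}\le l^+_{ij}$, $a_{ij}[l^-_{ij}]>0$, $o_{ij}(\varepsilon^{l^+_{ij}})/\varepsilon^{l^+_{ij}}\to0$. E: for $j\in\mathbb{Y}_i$, $e_{ij}(\varepsilon)=\sum_{l=m^-_{ij}}^{m^+_{ij}}b_{ij}[l]\varepsilon^l+\dot o_{ij}(\varepsilon^{m^+_{ij}})$ on $(0,\varepsilon_0]$ with integers $m^-_{ij}\le m^+_{ij}$, $b_{ij}[m^-_{ij}]>0$, $\dot o_{ij}(\varepsilon^{m^+_{ij}})/\varepsilon^{m^+_{ij}}\to0$. (B and C are required for all $i,j$ and $\varepsilon\in(0,\varepsilon_0]$.) Reduced process: $_r\xi_0=0$, $_r\xi_n=\min\{k>{}_r\xi_{n-1}:\eta^{(\varepsilon)}_k\in{}_r\mathbb{X}\}$; $_r\eta^{(\varepsilon)}_n=\eta^{(\varepsilon)}_{_r\xi_n}$, $_r\kappa^{(\varepsilon)}_0=0$, $_r\kappa^{(\varepsilon)}_n=\sum_{k={}_r\xi_{n-1}+1}^{_r\xi_n}\kappa^{(\varepsilon)}_k$;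 this is a Markov renewal process on $_r\mathbb{X}\times[0,\infty)$ with transition probabilities $_rQ^{(\varepsilon)}_{ij}(t)$, and $_r\eta^{(\varepsilon)}(t)$ is its semi-Markov process. $_rp_{ij}(\varepsilon)={}_rQ^{(\varepsilon)}_{ij}(\infty)$, $_re_{ij}(\varepsilon)=\int_0^\infty t\,{}_rQ^{(\varepsilon)}_{ij}(dt)$. Sets: $\mathbb{Y}^-_{ir}=\{j\in{}_r\mathbb{X}:j\in\mathbb{Y}_r\}$ if $r\in\mathbb{Y}_i$, else $\emptyset$; $\mathbb{Y}^+_{ir}=\{j\in{}_r\mathbb{X}:j\in\mathbb{Y}_i\}$. *)

theory Defs
  imports "HOL-Probability.Probability"
begin

text \<open>Semi-Markov transition kernel on a state set X: for i, j in X,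
  Q i j is the (finite) measure on the real line with Q i j {..t} = Q_ij(t);
  it is concentrated on [0,oo) and the total masses p_ij = Q_ij(oo) form a
  stochastic matrix.\<close>
definition sm_kernel :: "nat set \<Rightarrow> (nat \<Rightarrow> nat \<Rightarrow> real measure) \<Rightarrow> bool" where
  "sm_kernel X K \<longleftrightarrow>
     (\<forall>i\<in>X. \<forall>j\<in>X. finite_measure (K i j) \<and> sets (K i j) = sets borel
                    \<and> emeasure (K i j) {..<0} = 0) \<and>
     (\<forall>i\<in>X. (\<Sum>j\<in>X. measure (K i j) UNIV) = 1)"

definition kcdf :: "(nat \<Rightarrow> nat \<Rightarrow> real measure) \<Rightarrow> nat \<Rightarrow> nat \<Rightarrow> real \<Rightarrow> real" where
  "kcdf K i j t = measure (K i j) {..t}"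

definition kp :: "(nat \<Rightarrow> nat \<Rightarrow> real measure) \<Rightarrow> nat \<Rightarrow> nat \<Rightarrow> real" where
  "kp K i j = measure (K i j) UNIV"

definition ke_ext :: "(nat \<Rightarrow> nat \<Rightarrow> real measure) \<Rightarrow> nat \<Rightarrow> nat \<Rightarrow> ennreal" where
  "ke_ext K i j = (\<integral>\<^sup>+ t. ennreal t \<partial>(K i j))"

definition ke :: "(nat \<Rightarrow> nat \<Rightarrow> real measure) \<Rightarrow> nat \<Rightarrow> nat \<Rightarrow> real" where
  "ke K i j = enn2real (ke_ext K i j)"

text \<open>(eta_n, kappa_n) is a homogeneous Markov renewal process on X x [0,oo) with
  transition probabilities Q, i.e. a Markov chain whose one-step transition law
  P{eta_(n+1) = j, kappa_(n+1) <= t | eta_n = i, kappa_n = s, history} = Q_ij(t);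
  stated via the joint law of the cylinder events, with kappa_0 = 0.\<close>
definition MRP :: "nat set \<Rightarrow> 'a measure \<Rightarrow> (nat \<Rightarrow> 'a \<Rightarrow> nat) \<Rightarrow> (nat \<Rightarrow> 'a \<Rightarrow> real)
                    \<Rightarrow> (nat \<Rightarrow> nat \<Rightarrow> real measure) \<Rightarrow> bool" where
  "MRP X M eta kappa Q \<longleftrightarrow>
     prob_space M \<and>
     (\<forall>n. eta n \<in> measurable M (count_space UNIV)) \<and>
     (\<forall>n. kappa n \<in> borel_measurable M) \<and>
     (AE \<omega> in M. kappa 0 \<omega> = 0 \<and> (\<forall>n. eta n \<omega> \<in> X)) \<and>
     (\<forall>n (ss::nat \<Rightarrow> nat) (ts::nat \<Rightarrow> real) j t.
        measure M {\<omega>\<in>space M. (\<forall>k\<le>n. eta k \<omega> = ss k) \<and> (\<forall>k\<in>{1..n}. kappa k \<omega> \<le> ts k)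
                      \<and> eta (Suc n) \<omega> = j \<and> kappa (Suc n) \<omega> \<le> t}
        = measure M {\<omega>\<in>space M. (\<forall>k\<le>n. eta k \<omega> = ss k) \<and> (\<forall>k\<in>{1..n}. kappa k \<omega> \<le> ts k)}
          * kcdf Q (ss n) j t)"

primrec rxi :: "nat set \<Rightarrow> (nat \<Rightarrow> 'a \<Rightarrow> nat) \<Rightarrow> nat \<Rightarrow> 'a \<Rightarrow> nat" where
  "rxi RX eta 0 \<omega> = 0"
| "rxi RX eta (Suc n) \<omega> = (LEAST k. k > rxi RX eta n \<omega> \<and> eta k \<omega> \<in> RX)"

definition reta :: "nat set \<Rightarrow> (nat \<Rightarrow> 'a \<Rightarrow> nat) \<Rightarrow> nat \<Rightarrow> 'a \<Rightarrow> nat" where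
  "reta RX eta n \<omega> = eta (rxi RX eta n \<omega>) \<omega>"

definition rkappa :: "nat set \<Rightarrow> (nat \<Rightarrow> 'a \<Rightarrow> nat) \<Rightarrow> (nat \<Rightarrow> 'a \<Rightarrow> real) \<Rightarrow> nat \<Rightarrow> 'a \<Rightarrow> real" where
  "rkappa RX eta kappa n \<omega> =
     (case n of 0 \<Rightarrow> 0
      | Suc m \<Rightarrow> (\<Sum>k\<in>{Suc (rxi RX eta m \<omega>)..rxi RX eta (Suc m) \<omega>}. kappa k \<omega>))"

definition condA :: "nat set \<Rightarrow> (real \<Rightarrow> nat \<Rightarrow> nat \<Rightarrow> real measure) \<Rightarrow> real \<Rightarrow> (nat \<Rightarrow> nat set) \<Rightarrow> bool" where
  "condA X Q eps0 Y \<longleftrightarrow>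
     (\<forall>i\<in>X. Y i \<subseteq> X) \<and>
     (\<forall>eps\<in>{0<..eps0}. \<forall>i\<in>X. \<forall>j\<in>X.
        (j \<in> Y i \<longrightarrow> kp (Q eps) i j > 0) \<and> (j \<notin> Y i \<longrightarrow> kp (Q eps) i j = 0)) \<and>
     (\<forall>i\<in>X. \<forall>j\<in>X. \<exists>n\<ge>1. \<exists>l::nat \<Rightarrow> nat. l 0 = i \<and> l n = j \<and> (\<forall>k<n. l (Suc k) \<in> Y (l k)))"

definition condB :: "nat set \<Rightarrow> (real \<Rightarrow> nat \<Rightarrow> nat \<Rightarrow> real measure) \<Rightarrow> real \<Rightarrow> bool" where
  "condB X Q eps0 \<longleftrightarrow> (\<forall>eps\<in>{0<..eps0}. \<forall>i\<in>X. \<forall>j\<in>X. kcdf (Q eps) i j 0 = 0)"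

definition condC :: "nat set \<Rightarrow> (real \<Rightarrow> nat \<Rightarrow> nat \<Rightarrow> real measure) \<Rightarrow> real \<Rightarrow> bool" where
  "condC X Q eps0 \<longleftrightarrow> (\<forall>eps\<in>{0<..eps0}. \<forall>i\<in>X. \<forall>j\<in>X. ke_ext (Q eps) i j < \<infinity>)"

definition condD :: "nat set \<Rightarrow> (real \<Rightarrow> nat \<Rightarrow> nat \<Rightarrow> real measure) \<Rightarrow> real \<Rightarrow> (nat \<Rightarrow> nat set) \<Rightarrow> bool" where
  "condD X Q eps0 Y \<longleftrightarrow>
     (\<forall>i\<in>X. \<forall>j\<in>Y i. \<exists>(lm::nat) (lp::nat) (a::nat \<Rightarrow> real) (rem::real \<Rightarrow> real).
        lm \<le> lp \<and> a lm > 0 \<and>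
        (\<forall>eps\<in>{0<..eps0}. kp (Q eps) i j = (\<Sum>l\<in>{lm..lp}. a l * eps ^ l) + rem eps) \<and>
        ((\<lambda>eps. rem eps / eps ^ lp) \<longlongrightarrow> 0) (at_right 0))"

definition condE :: "nat set \<Rightarrow> (real \<Rightarrow> nat \<Rightarrow> nat \<Rightarrow> real measure) \<Rightarrow> real \<Rightarrow> (nat \<Rightarrow> nat set) \<Rightarrow> bool" where
  "condE X Q eps0 Y \<longleftrightarrow>
     (\<forall>i\<in>X. \<forall>j\<in>Y i. \<exists>(mm::int) (mp::int) (b::int \<Rightarrow> real) (rem::real \<Rightarrow> real).
        mm \<le> mp \<and> b mm > 0 \<and>
        (\<forall>eps\<in>{0<..eps0}. ke (Q eps) i j = (\<Sum>l\<in>{mm..mp}. b l * eps powi l) + rem eps) \<and>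
        ((\<lambda>eps. rem eps / eps powi mp) \<longlongrightarrow> 0) (at_right 0))"

definition condABCDE :: "nat set \<Rightarrow> (real \<Rightarrow> nat \<Rightarrow> nat \<Rightarrow> real measure) \<Rightarrow> real \<Rightarrow> (nat \<Rightarrow> nat set) \<Rightarrow> bool" where
  "condABCDE X Q eps0 Y \<longleftrightarrow>
     condA X Q eps0 Y \<and> condB X Q eps0 \<and> condC X Q eps0 \<and> condD X Q eps0 Y \<and> condE X Q eps0 Y"

definition Yminus :: "nat set \<Rightarrow> (nat \<Rightarrow> nat set) \<Rightarrow> nat \<Rightarrow> nat \<Rightarrow> nat set" where
  "Yminus X Y i r = (if r \<in> Y i then {j \<in> X - {r}. j \<in> Y r} else {})"

definition Yplus :: "nat set \<Rightarrow> (nat \<Rightarrow> nat set) \<Rightarrow> nat \<Rightarrow> nat \<Rightarrow> nat set" where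
  "Yplus X Y i r = {j \<in> X - {r}. j \<in> Y i}"

end

theory Submission
  imports Defs
begin

text \<open>Almost surely the chain leaves r after every visit, so prescribing the reduced chain up
  to step n is, as an event, a countable disjoint union of trajectories w of the original chain
  with last state i \<noteq> r, and the next reduced step to j extends w by q copies of r followed by j.
  Conditionally on w, such an excursion has probability p_ij (q = 0) or
  p_ir p_rr^(q-1) p_rj (q \<ge> 1), whatever w is. Summing the geometric series over q gives
    rp_ij = p_ij + p_ir p_rj / (1 - p_rr),
    re_ij = e_ij + (e_ir p_rj + p_ir e_rj) / (1 - p_rr) + p_ir e_rr p_rj / (1 - p_rr)^2.
  These are built from nonnegative functions by sums, products and quotients, and
  1 - p_rr is the sum of p_rj over j \<noteq> r; no cancellation of leading terms can occur.\<close>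

text \<open>The kernel \<open>rQ\<close> is not given by a formula. It is known only through the
  joint law of the reduced process, where its row at \<open>i\<close> appears multiplied by the
  probability of a history ending in \<open>i\<close>. Masses and means are therefore found by
  evaluating one integral in two ways and cancelling that probability, and connectivity must supply
  a history for which it is positive. The law of the chain is stated through separate bounds on the
  sojourn times, not through their sums. Convolutions are avoided because the conditions on
  durations concern only positivity and means: linearity of expectation reduces an excursion to
  single sojourn times. Entries outside the transition sets vanish and have no pivotal expansion, so
  the calculus of expansions admits zero functions, and positivity of the reduced characteristic
  rules them out at the end. Division may produce negative exponents, whereas D asks for natural
  ones; for probabilities boundedness by 1 settles this.\<close>

text \<open>Finite Borel measures on the line with equal distribution functions coincide; this is
  applied to the images under \<open>f1\<close> and \<open>f2\<close> of the restricted measures. It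
  turns identities for events "time at most t" into identities for expectations.\<close>

lemma set_nn_integral_eq_of_cdf:
  fixes f1 :: "'a \<Rightarrow> real" and f2 :: "'b \<Rightarrow> real" and h :: "real \<Rightarrow> ennreal"
  assumes fin: "finite_measure M1" "finite_measure M2"
    and f: "f1 \<in> borel_measurable M1" "f2 \<in> borel_measurable M2"
    and A: "A1 \<in> sets M1" "A2 \<in> sets M2"
    and h: "h \<in> borel_measurable borel" and c: "0 \<le> c"
    and cdf: "\<And>t. measure M1 (A1 \<inter> {\<omega>\<in>space M1. f1 \<omega> \<le> t})
                  = c * measure M2 (A2 \<inter> {\<omega>\<in>space M2. f2 \<omega> \<le> t})"
  shows "(\<integral>\<^sup>+\<omega>\<in>A1. h (f1 \<omega>) \<partial>M1) = ennreal c * (\<integral>\<^sup>+\<omega>\<in>A2. h (f2 \<omega>) \<partial>M2)"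
proof -
  define D1 where "D1 = distr (density M1 (indicator A1)) borel f1"
  define D2 where "D2 = distr (density M2 (\<lambda>\<omega>. ennreal c * indicator A2 \<omega>)) borel f2"
  note [measurable] = f A h
  interpret M1: finite_measure M1 by fact
  interpret M2: finite_measure M2 by fact
  have e1: "emeasure D1 B = emeasure M1 (A1 \<inter> (f1 -` B \<inter> space M1))" if "B \<in> sets borel" for B
    using that unfolding D1_def
    by (subst emeasure_distr) (auto intro!: emeasure_restricted measurable_sets[OF f(1)])
  have e2: "emeasure D2 B = ennreal c * emeasure M2 (A2 \<inter> (f2 -` B \<inter> space M2))"
    if "B \<in> sets borel" for B
  proof -
    have [measurable]: "B \<in> sets borel" by fact
    have B': "f2 -` B \<inter> space M2 \<in> sets M2" by (rule measurable_sets[OF f(2) that])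
    have "emeasure D2 B = emeasure (density M2 (\<lambda>\<omega>. ennreal c * indicator A2 \<omega>)) (f2 -` B \<inter> space M2)"
      unfolding D2_def by (subst emeasure_distr) auto
    also have "\<dots> = (\<integral>\<^sup>+\<omega>. ennreal c * indicator A2 \<omega> * indicator (f2 -` B \<inter> space M2) \<omega> \<partial>M2)"
      using B' by (subst emeasure_density) auto
    also have "\<dots> = (\<integral>\<^sup>+\<omega>. ennreal c * indicator (A2 \<inter> (f2 -` B \<inter> space M2)) \<omega> \<partial>M2)"
      by (intro nn_integral_cong) (auto split: split_indicator)
    also have "\<dots> = ennreal c * emeasure M2 (A2 \<inter> (f2 -` B \<inter> space M2))"
      using B' A by (subst nn_integral_cmult_indicator) auto
    finally show "emeasure D2 B = ennreal c * emeasure M2 (A2 \<inter> (f2 -` B \<inter> space M2))" .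
  qed
  have sp: "space D1 = UNIV" "space D2 = UNIV" by (auto simp: D1_def D2_def)
  have fD1: "finite_borel_measure D1"
  proof (intro finite_borel_measure.intro finite_borel_measure_axioms.intro finite_measureI)
    show "sets D1 = sets borel" by (simp add: D1_def)
    show "emeasure D1 (space D1) \<noteq> \<infinity>" by (simp add: sp e1)
  qed
  have fD2: "finite_borel_measure D2"
  proof (intro finite_borel_measure.intro finite_borel_measure_axioms.intro finite_measureI)
    show "sets D2 = sets borel" by (simp add: D2_def)
    show "emeasure D2 (space D2) \<noteq> \<infinity>" by (simp add: sp e2 ennreal_mult_eq_top_iff)
  qed
  have "D1 = D2"
  proof (rule cdf_unique'[OF fD1 fD2], rule ext)
    fix t
    have v: "f1 -` {..t} \<inter> space M1 = {\<omega>\<in>space M1. f1 \<omega> \<le> t}"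
      "f2 -` {..t} \<inter> space M2 = {\<omega>\<in>space M2. f2 \<omega> \<le> t}" by auto
    have "cdf D1 t = measure M1 (A1 \<inter> {\<omega>\<in>space M1. f1 \<omega> \<le> t})"
      by (simp add: cdf_def measure_def e1 v)
    also have "\<dots> = cdf D2 t"
      using c by (simp add: cdf_def measure_def e2 v enn2real_mult cdf[unfolded measure_def])
    finally show "cdf D1 t = cdf D2 t" .
  qed
  then have "(\<integral>\<^sup>+x. h x \<partial>D1) = (\<integral>\<^sup>+x. h x \<partial>D2)" by simp
  moreover have "(\<integral>\<^sup>+x. h x \<partial>D1) = (\<integral>\<^sup>+\<omega>\<in>A1. h (f1 \<omega>) \<partial>M1)"
    unfolding D1_def
    by (simp add: nn_integral_distr nn_integral_density mult.commute)
  moreover have "(\<integral>\<^sup>+x. h x \<partial>D2) = ennreal c * (\<integral>\<^sup>+\<omega>\<in>A2. h (f2 \<omega>) \<partial>M2)"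
    unfolding D2_def
    by (simp add: nn_integral_distr nn_integral_density nn_integral_cmult[symmetric] mult_ac)
  ultimately show ?thesis by simp
qed

subsection \<open>Markov renewal processes along trajectories\<close>

locale markov_renewal =
  fixes X :: "nat set" and M :: "'a measure" and eta :: "nat \<Rightarrow> 'a \<Rightarrow> nat"
    and kappa :: "nat \<Rightarrow> 'a \<Rightarrow> real" and Q :: "nat \<Rightarrow> nat \<Rightarrow> real measure"
  assumes mrp: "MRP X M eta kappa Q" and ker: "sm_kernel X Q"
begin

sublocale prob_space M
  using mrp by (simp add: MRP_def)

lemma eta_measurable [measurable]: "eta n \<in> measurable M (count_space UNIV)"
  and kappa_measurable [measurable]: "kappa n \<in> borel_measurable M"
  using mrp by (auto simp: MRP_def)

lemma AE_eta_in: "AE \<omega> in M. \<forall>n. eta n \<omega> \<in> X"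
  using mrp by (auto simp: MRP_def)

lemma finite_Q: "i \<in> X \<Longrightarrow> j \<in> X \<Longrightarrow> finite_measure (Q i j)"
  and sets_Q: "i \<in> X \<Longrightarrow> j \<in> X \<Longrightarrow> sets (Q i j) = sets borel"
  and sum_kp: "i \<in> X \<Longrightarrow> (\<Sum>j\<in>X. kp Q i j) = 1"
  using ker by (auto simp: sm_kernel_def kp_def)

lemma space_Q: "i \<in> X \<Longrightarrow> j \<in> X \<Longrightarrow> space (Q i j) = UNIV"
  using sets_Q[THEN sets_eq_imp_space_eq] by simp

lemma kp_nonneg: "0 \<le> kp Q i j"
  by (simp add: kp_def)

lemma kcdf_tendsto_kp:
  assumes "i \<in> X" "j \<in> X"
  shows "(\<lambda>N. kcdf Q i j (real N)) \<longlonglongrightarrow> kp Q i j"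
proof -
  interpret finite_measure "Q i j" using assms by (rule finite_Q)
  have "(\<Union>N. {..real N}) = (UNIV :: real set)"
    by (auto intro: real_arch_simple)
  moreover have "(\<lambda>N. measure (Q i j) {..real N}) \<longlonglongrightarrow> measure (Q i j) (\<Union>N. {..real N})"
    using assms by (intro finite_Lim_measure_incseq) (auto simp: sets_Q incseq_def)
  ultimately show ?thesis by (simp add: kcdf_def kp_def)
qed

lemma measure_step:
  "measure M {\<omega>\<in>space M. (\<forall>k\<le>n. eta k \<omega> = ss k) \<and> (\<forall>k\<in>{1..n}. kappa k \<omega> \<le> ts k)
      \<and> eta (Suc n) \<omega> = j \<and> kappa (Suc n) \<omega> \<le> t}
   = measure M {\<omega>\<in>space M. (\<forall>k\<le>n. eta k \<omega> = ss k) \<and> (\<forall>k\<in>{1..n}. kappa k \<omega> \<le> ts k)}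
     * kcdf Q (ss n) j t"
  using mrp unfolding MRP_def by blast

lemma tendsto_measure_unbounded:
  fixes f :: "nat \<Rightarrow> 'a \<Rightarrow> real"
  assumes A [measurable]: "A \<in> sets M" "\<And>k. f k \<in> borel_measurable M" and K: "finite K"
  shows "(\<lambda>N. measure M (A \<inter> {\<omega>\<in>space M. \<forall>k\<in>K. f k \<omega> \<le> real N})) \<longlonglongrightarrow> measure M A"
proof -
  have "A = (\<Union>N. A \<inter> {\<omega>\<in>space M. \<forall>k\<in>K. f k \<omega> \<le> real N})"
  proof (intro equalityI subsetI)
    fix \<omega> assume a: "\<omega> \<in> A"
    obtain N :: nat where "Max (insert 0 ((\<lambda>k. f k \<omega>) ` K)) \<le> real N"
      using real_arch_simple by blast
    then have "\<forall>k\<in>K. f k \<omega> \<le> real N"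
      using K by simp
    with a sets.sets_into_space[OF A(1)] 
    show "\<omega> \<in> (\<Union>N. A \<inter> {\<omega>\<in>space M. \<forall>k\<in>K. f k \<omega> \<le> real N})" by blast
  qed auto
  moreover have "(\<lambda>N. measure M (A \<inter> {\<omega>\<in>space M. \<forall>k\<in>K. f k \<omega> \<le> real N}))
     \<longlonglongrightarrow> measure M (\<Union>N. A \<inter> {\<omega>\<in>space M. \<forall>k\<in>K. f k \<omega> \<le> real N})"
    using countable_finite[OF K] by (intro finite_Lim_measure_incseq) (force simp: incseq_def)+
  ultimately show ?thesis by simp
qed

text \<open>Histories are lists, so that an excursion is appended by \<open>@\<close>, and there are
  only countably many of them, so that almost sure statements hold for all histories at
  once.\<close>

definition cyl :: "nat list \<Rightarrow> 'a set" where
  "cyl w = {\<omega>\<in>space M. \<forall>k<length w. eta k \<omega> = w ! k}"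

lemma cyl_sets [measurable]: "cyl w \<in> sets M"
  unfolding cyl_def by measurable

lemma cyl_append_subset: "cyl (u @ v) \<subseteq> cyl u"
  by (force simp: cyl_def nth_append)

lemma cyl_snoc_iff: "\<omega> \<in> cyl (w @ [y]) \<longleftrightarrow> \<omega> \<in> cyl w \<and> eta (length w) \<omega> = y"
  by (auto simp: cyl_def nth_append less_Suc_eq)

text \<open>The time bounds outside L in the definition of a Markov renewal process are removed by
  letting them tend to infinity.\<close>
lemma measure_cyl_snoc_constr:
  fixes L :: "nat set" and s t :: real
  assumes w: "w \<noteq> []" "last w \<in> X" "y \<in> X"
  defines "C \<equiv> {\<omega>\<in>space M. \<forall>k\<in>{1..<length w} \<inter> L. kappa k \<omega> \<le> t}"
  shows "measure M (cyl (w @ [y]) \<inter> C \<inter> {\<omega>\<in>space M. kappa (length w) \<omega> \<le> s})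
       = measure M (cyl w \<inter> C) * kcdf Q (last w) y s" (is "?A = ?B * _")
    and "measure M (cyl (w @ [y]) \<inter> C) = measure M (cyl w \<inter> C) * kp Q (last w) y"
proof -
  have [measurable]: "C \<in> sets M" unfolding C_def by measurable
  \<comment> \<open>A list of length n + 1 records the states at times 0 to n; the appended state
    and its sojourn time thus have index \<open>length w\<close>.\<close>
  define n where "n = length w - 1"
  have n: "length w = Suc n" "last w = w ! n" using w by (auto simp: n_def last_conv_nth)
  define K where "K = {1..n} - L"
  define D where "D N = {\<omega>\<in>space M. \<forall>k\<in>K. kappa k \<omega> \<le> real N}" for N
  have [measurable]: "D N \<in> sets M" for N unfolding D_def K_def by measurable
  have eq: "measure M ((cyl (w @ [y]) \<inter> C \<inter> {\<omega>\<in>space M. kappa (length w) \<omega> \<le> s}) \<inter> D N)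
        = measure M ((cyl w \<inter> C) \<inter> D N) * kcdf Q (last w) y s" for N s
  proof -
    define ts where "ts k = (if k \<in> L then t else real N)" for k
    have CD: "\<omega> \<in> C \<and> \<omega> \<in> D N \<longleftrightarrow> \<omega> \<in> space M \<and> (\<forall>k\<in>{1..n}. kappa k \<omega> \<le> ts k)" for \<omega>
      unfolding C_def D_def K_def ts_def using n by (auto simp: less_Suc_eq_le)
    have 1: "(cyl (w @ [y]) \<inter> C \<inter> {\<omega>\<in>space M. kappa (length w) \<omega> \<le> s}) \<inter> D N
      = {\<omega>\<in>space M. (\<forall>k\<le>n. eta k \<omega> = w ! k) \<and> (\<forall>k\<in>{1..n}. kappa k \<omega> \<le> ts k)
        \<and> eta (Suc n) \<omega> = y \<and> kappa (Suc n) \<omega> \<le> s}"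
      using CD unfolding set_eq_iff Int_iff cyl_snoc_iff
      by (simp add: n cyl_def less_Suc_eq_le) blast
    have 2: "(cyl w \<inter> C) \<inter> D N
      = {\<omega>\<in>space M. (\<forall>k\<le>n. eta k \<omega> = w ! k) \<and> (\<forall>k\<in>{1..n}. kappa k \<omega> \<le> ts k)}"
      using CD by (auto simp: n cyl_def less_Suc_eq_le)
    show ?thesis unfolding 1 2 n(2) by (rule measure_step)
  qed
  have K: "finite K" by (simp add: K_def)
  note lim = tendsto_measure_unbounded[where K=K and f=kappa, OF _ kappa_measurable K, folded D_def]
  have main: "measure M (cyl (w @ [y]) \<inter> C \<inter> {\<omega>\<in>space M. kappa (length w) \<omega> \<le> s})
       = measure M (cyl w \<inter> C) * kcdf Q (last w) y s" for s
  proof (rule LIMSEQ_unique)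
    show "(\<lambda>N. measure M ((cyl (w @ [y]) \<inter> C \<inter> {\<omega>\<in>space M. kappa (length w) \<omega> \<le> s}) \<inter> D N))
       \<longlonglongrightarrow> measure M (cyl (w @ [y]) \<inter> C \<inter> {\<omega>\<in>space M. kappa (length w) \<omega> \<le> s})"
      by (rule lim) measurable
    show "(\<lambda>N. measure M ((cyl (w @ [y]) \<inter> C \<inter> {\<omega>\<in>space M. kappa (length w) \<omega> \<le> s}) \<inter> D N))
       \<longlonglongrightarrow> measure M (cyl w \<inter> C) * kcdf Q (last w) y s"
      unfolding eq by (intro tendsto_mult lim tendsto_const) measurable
  qed
  then show "?A = ?B * kcdf Q (last w) y s" .
  \<comment> \<open>Here the bound on the newest sojourn time is released as well, which turns
    \<open>kcdf\<close> into \<open>kp\<close>.\<close>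
  show "measure M (cyl (w @ [y]) \<inter> C) = measure M (cyl w \<inter> C) * kp Q (last w) y"
  proof (rule LIMSEQ_unique)
    show "(\<lambda>N. measure M (cyl (w @ [y]) \<inter> C \<inter> {\<omega>\<in>space M. kappa (length w) \<omega> \<le> real N}))
       \<longlonglongrightarrow> measure M (cyl (w @ [y]) \<inter> C)"
      using tendsto_measure_unbounded[where K="{length w}" and f=kappa, of "cyl (w @ [y]) \<inter> C"]
      by simp
    show "(\<lambda>N. measure M (cyl (w @ [y]) \<inter> C \<inter> {\<omega>\<in>space M. kappa (length w) \<omega> \<le> real N}))
       \<longlonglongrightarrow> measure M (cyl w \<inter> C) * kp Q (last w) y"
      unfolding main using w by (intro tendsto_mult kcdf_tendsto_kp tendsto_const) auto
  qed
qed

lemma measure_cyl_snoc_le: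
  assumes "w \<noteq> []" "last w \<in> X" "y \<in> X"
  shows "measure M (cyl (w @ [y]) \<inter> {\<omega>\<in>space M. kappa (length w) \<omega> \<le> s})
       = measure M (cyl w) * kcdf Q (last w) y s"
  \<comment> \<open>With \<open>L\<close> empty no bound on earlier times remains; the value 0 for
    \<open>t\<close> is a dummy.\<close>
  using measure_cyl_snoc_constr(1)[OF assms, of "{}" 0 s] by (simp add: Int_absorb2 cyl_def)

lemma measure_cyl_snoc:
  assumes "w \<noteq> []" "last w \<in> X" "y \<in> X"
  shows "measure M (cyl (w @ [y])) = measure M (cyl w) * kp Q (last w) y"
  using measure_cyl_snoc_constr(2)[OF assms, of "{}" 0] by (simp add: Int_absorb2 cyl_def)

lemma nn_integral_cyl_snoc:
  assumes w: "w \<noteq> []" "last w \<in> X" "y \<in> X"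
  shows "(\<integral>\<^sup>+\<omega>\<in>cyl (w @ [y]). ennreal (kappa (length w) \<omega>) \<partial>M)
       = ennreal (measure M (cyl w)) * ke_ext Q (last w) y"
proof -
  have "(\<integral>\<^sup>+\<omega>\<in>cyl (w @ [y]). ennreal (kappa (length w) \<omega>) \<partial>M)
     = ennreal (measure M (cyl w)) * (\<integral>\<^sup>+t\<in>UNIV. ennreal t \<partial>Q (last w) y)"
    using w
    by (intro set_nn_integral_eq_of_cdf)
       (auto simp: finite_Q sets_Q space_Q measure_cyl_snoc_le kcdf_def atMost_def
          finite_measure_axioms intro: measurable_ident_sets)
  then show ?thesis by (simp add: ke_ext_def)
qed

text \<open>Taking \<open>L = {l}\<close> keeps a single time bound, so appending a state rescales
  the law of an earlier sojourn time by the transition probability. This is all the conditional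
  independence that the means require.\<close>

lemma nn_integral_cyl_snoc_earlier:
  assumes w: "w \<noteq> []" "last w \<in> X" "y \<in> X" and l: "1 \<le> l" "l < length w"
  shows "(\<integral>\<^sup>+\<omega>\<in>cyl (w @ [y]). ennreal (kappa l \<omega>) \<partial>M)
       = ennreal (kp Q (last w) y) * (\<integral>\<^sup>+\<omega>\<in>cyl w. ennreal (kappa l \<omega>) \<partial>M)"
proof (rule set_nn_integral_eq_of_cdf)
  fix t
  have "{1..<length w} \<inter> {l} = {l}" using l by auto
  then show "measure M (cyl (w @ [y]) \<inter> {\<omega>\<in>space M. kappa l \<omega> \<le> t})
     = kp Q (last w) y * measure M (cyl w \<inter> {\<omega>\<in>space M. kappa l \<omega> \<le> t})"
    using measure_cyl_snoc_constr(2)[OF w, of "{l}" t] by simp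
qed (auto simp: kp_nonneg finite_measure_axioms)

end

subsection \<open>The embedded chain outside r\<close>

text \<open>What the excursion calculus takes from A, B and C at one fixed parameter value:
  \<open>not_absorbing\<close> makes the geometric series converge, \<open>no_jump_at_0\<close>
  makes durations positive, \<open>finite_mean\<close> allows real arithmetic with means.\<close>

locale state_removal = markov_renewal X M eta kappa Q
  for X :: "nat set" and M :: "'a measure" and eta kappa Q +
  fixes r :: nat
  assumes r_in: "r \<in> X" and not_absorbing: "kp Q r r < 1"
    and start: "AE \<omega> in M. eta 0 \<omega> \<noteq> r"
    and no_jump_at_0: "\<And>i j. i \<in> X \<Longrightarrow> j \<in> X \<Longrightarrow> kcdf Q i j 0 = 0"
    and finite_mean: "\<And>i j. i \<in> X \<Longrightarrow> j \<in> X \<Longrightarrow> ke_ext Q i j < \<infinity>"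
begin

text \<open>The last conjunct ensures that the LEAST in the definition of rxi is never taken over an
  empty set.\<close>
definition good :: "'a \<Rightarrow> bool" where
  "good \<omega> \<longleftrightarrow> \<omega> \<in> space M \<and> (\<forall>n. eta n \<omega> \<in> X) \<and> (\<forall>k\<ge>1. 0 < kappa k \<omega>) \<and>
     eta 0 \<omega> \<noteq> r \<and> (\<forall>m. \<exists>k>m. eta k \<omega> \<noteq> r)"

abbreviation traj :: "nat \<Rightarrow> 'a \<Rightarrow> nat list" where
  "traj n \<omega> \<equiv> map (\<lambda>k. eta k \<omega>) [0..<n]"

lemma cyl_iff_traj: "\<omega> \<in> cyl w \<longleftrightarrow> \<omega> \<in> space M \<and> (\<exists>m. w = traj m \<omega>)"
proof
  assume "\<omega> \<in> cyl w"
  moreover from this have "w = traj (length w) \<omega>"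
    by (intro nth_equalityI) (simp_all add: cyl_def)
  ultimately show "\<omega> \<in> space M \<and> (\<exists>m. w = traj m \<omega>)" by (auto simp only: cyl_def)
qed (auto simp: cyl_def)

lemma traj_in_cyl: "\<omega> \<in> space M \<Longrightarrow> \<omega> \<in> cyl (traj n \<omega>)"
  by (simp add: cyl_def)

lemma measure_cyl_replicate:
  assumes "w \<noteq> []" "last w \<in> X"
  shows "measure M (cyl (w @ replicate (Suc q) r)) = measure M (cyl w) * kp Q (last w) r * kp Q r r ^ q"
proof (induction q)
  case 0
  then show ?case using measure_cyl_snoc[OF assms r_in] by simp
next
  case (Suc q)
  define u where "u = w @ replicate (Suc q) r"
  \<comment> \<open>\<open>replicate\<close> unfolds on the left, while trajectories are extended on
    the right.\<close>
  have "w @ replicate (Suc (Suc q)) r = u @ [r]"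
    unfolding u_def append_assoc replicate_append_same by simp
  moreover have "last u = r" "u \<noteq> []" by (simp_all add: u_def)
  ultimately show ?case
    using measure_cyl_snoc[of u r] r_in Suc[folded u_def] by simp
qed

section \<open>Almost sure properties of paths\<close>

text \<open>For each finite history the event of a nonpositive next sojourn time is null.
  Countability of the histories gives one exceptional null set, and each remaining path is tested on
  its own trajectory.\<close>

lemma AE_kappa_pos: "AE \<omega> in M. \<forall>k\<ge>1. 0 < kappa k \<omega>"
proof -
  have "AE \<omega> in M. w \<noteq> [] \<longrightarrow> last w \<in> X \<longrightarrow> y \<in> X \<longrightarrow> \<omega> \<in> cyl (w @ [y]) \<longrightarrow> 0 < kappa (length w) \<omega>"
    for w y
  proof (cases "w \<noteq> [] \<and> last w \<in> X \<and> y \<in> X")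
    case True
    let ?Z = "cyl (w @ [y]) \<inter> {\<omega>\<in>space M. kappa (length w) \<omega> \<le> 0}"
    have "measure M ?Z = 0"
      using True measure_cyl_snoc_le[of w y 0] no_jump_at_0 by simp
    moreover have "?Z \<in> sets M" by measurable
    ultimately have "?Z \<in> null_sets M"
      by (intro null_setsI) (simp_all only: emeasure_eq_measure ennreal_0)
    then have "AE \<omega> in M. \<omega> \<notin> ?Z" by (rule AE_not_in)
    with AE_space show ?thesis by eventually_elim auto
  qed auto
  then have "AE \<omega> in M. \<forall>w y. w \<noteq> [] \<longrightarrow> last w \<in> X \<longrightarrow> y \<in> X \<longrightarrow> \<omega> \<in> cyl (w @ [y])
      \<longrightarrow> 0 < kappa (length w) \<omega>"
    unfolding AE_all_countable by blast
  with AE_eta_in AE_space show ?thesis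
  proof eventually_elim
    case (elim \<omega>)
    show ?case
    proof (intro allI impI)
      fix k :: nat assume "1 \<le> k"
      moreover have "\<omega> \<in> cyl (traj k \<omega> @ [eta k \<omega>])"
        using elim(2) by (simp add: cyl_snoc_iff traj_in_cyl)
      ultimately show "0 < kappa k \<omega>"
        using elim(1) elim(3)[rule_format, of "traj k \<omega>" "eta k \<omega>"] by (cases k) auto
    qed
  qed
qed

text \<open>Staying in \<open>r\<close> forever after \<open>w\<close> is contained in every
  \<open>cyl (w @ replicate (Suc q) r)\<close>, whose measure decays geometrically in
  \<open>q\<close>. Countability of histories does the rest.\<close>

lemma AE_leave: "AE \<omega> in M. \<forall>m. \<exists>k>m. eta k \<omega> \<noteq> r"
proof -
  have "AE \<omega> in M. w \<noteq> [] \<longrightarrow> last w \<in> X \<longrightarrow> \<omega> \<in> cyl w \<longrightarrow> (\<exists>k\<ge>length w. eta k \<omega> \<noteq> r)" for w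
  proof (cases "w \<noteq> [] \<and> last w \<in> X")
    case True
    let ?Z = "cyl w \<inter> {\<omega>\<in>space M. \<forall>k\<ge>length w. eta k \<omega> = r}"
    have Z: "?Z \<in> sets M" by measurable
    have le: "measure M ?Z \<le> measure M (cyl w) * kp Q (last w) r * kp Q r r ^ q" for q
    proof -
      have "?Z \<subseteq> cyl (w @ replicate (Suc q) r)"
      proof
        fix \<omega> assume "\<omega> \<in> ?Z"
        then show "\<omega> \<in> cyl (w @ replicate (Suc q) r)"
          by (simp add: cyl_def nth_append del: replicate_Suc)
      qed
      from finite_measure_mono[OF this cyl_sets] show ?thesis
        using measure_cyl_replicate[of w q] True by linarith
    qed
    have "(\<lambda>q. measure M (cyl w) * kp Q (last w) r * kp Q r r ^ q) \<longlonglongrightarrow> measure M (cyl w) * kp Q (last w) r * 0"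
      using not_absorbing kp_nonneg by (intro tendsto_mult_left LIMSEQ_power_zero) simp
    then have "measure M ?Z \<le> measure M (cyl w) * kp Q (last w) r * 0"
      by (rule LIMSEQ_le_const) (use le in blast)
    then have "measure M ?Z = 0" by (simp only: mult_zero_right measure_le_0_iff)
    then have "?Z \<in> null_sets M"
      using Z by (intro null_setsI) (simp_all only: emeasure_eq_measure ennreal_0)
    then have "AE \<omega> in M. \<omega> \<notin> ?Z" by (rule AE_not_in)
    with AE_space show ?thesis by eventually_elim auto
  qed auto
  then have "AE \<omega> in M. \<forall>w. w \<noteq> [] \<longrightarrow> last w \<in> X \<longrightarrow> \<omega> \<in> cyl w \<longrightarrow> (\<exists>k\<ge>length w. eta k \<omega> \<noteq> r)"
    unfolding AE_all_countable by blast
  with AE_eta_in AE_space show ?thesis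
  proof eventually_elim
    case (elim \<omega>)
    show ?case
    proof
      fix m
      have "\<omega> \<in> cyl (traj (Suc m) \<omega>)" using elim(2) by (rule traj_in_cyl)
      then show "\<exists>k>m. eta k \<omega> \<noteq> r"
        using elim(1) elim(3)[rule_format, of "traj (Suc m) \<omega>"] by (auto simp: Suc_le_eq)
    qed
  qed
qed

lemma AE_good: "AE \<omega> in M. good \<omega>"
  using AE_space AE_eta_in AE_kappa_pos AE_leave start
  by eventually_elim (simp add: good_def)

section \<open>Visits outside r and the reduced trajectory\<close>

abbreviation "RX \<equiv> X - {r}"
abbreviation "xi \<equiv> rxi RX eta"
abbreviation "Reta \<equiv> reta RX eta"
abbreviation "Rkappa \<equiv> rkappa RX eta kappa"

lemma xi_Suc:
  assumes "good \<omega>"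
  shows "xi n \<omega> < xi (Suc n) \<omega>" "eta (xi (Suc n) \<omega>) \<omega> \<noteq> r"
    and "\<And>k. xi n \<omega> < k \<Longrightarrow> k < xi (Suc n) \<omega> \<Longrightarrow> eta k \<omega> = r"
proof -
  obtain k where "k > xi n \<omega> \<and> eta k \<omega> \<in> RX"
    using assms unfolding good_def by blast
  from LeastI[where P="\<lambda>k. k > xi n \<omega> \<and> eta k \<omega> \<in> RX", OF this]
  show "xi n \<omega> < xi (Suc n) \<omega>" "eta (xi (Suc n) \<omega>) \<omega> \<noteq> r" by auto
  show "eta k \<omega> = r" if "xi n \<omega> < k" "k < xi (Suc n) \<omega>" for k
    using not_less_Least[where P="\<lambda>k. k > xi n \<omega> \<and> eta k \<omega> \<in> RX", of k] that assms
    by (auto simp: good_def)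
qed

lemma eta_xi: "good \<omega> \<Longrightarrow> eta (xi n \<omega>) \<omega> \<noteq> r"
  using xi_Suc(2) by (cases n) (auto simp: good_def)

lemma strict_mono_xi: "good \<omega> \<Longrightarrow> strict_mono (\<lambda>n. xi n \<omega>)"
  by (simp add: strict_mono_Suc_iff xi_Suc(1) del: rxi.simps)

text \<open>Between consecutive values of \<open>xi\<close> the chain is in \<open>r\<close>, so a
  skipped visit at time m would keep all values of \<open>xi\<close> below m. A strictly increasing
  sequence of naturals has \<open>m \<le> xi m\<close>.\<close>

lemma visit_in_range_xi:
  assumes "good \<omega>" "eta m \<omega> \<noteq> r"
  shows "\<exists>n. xi n \<omega> = m"
proof (rule ccontr)
  assume no: "\<nexists>n. xi n \<omega> = m"
  have "xi n \<omega> < m" for n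
  proof (induction n)
    case 0
    show ?case using no by (metis bot_nat_0.not_eq_extremum rxi.simps(1))
  next
    case (Suc n)
    show ?case
      using xi_Suc(3)[OF assms(1) Suc] assms(2) no by (metis linorder_neqE_nat)
  qed
  moreover have "m \<le> xi m \<omega>"
    using strict_mono_xi[OF assms(1)] by (rule strict_mono_imp_increasing)
  ultimately show False by (simp add: not_less[symmetric])
qed

text \<open>Reduction amounts to deleting \<open>r\<close> from the trajectory. Since
  \<open>rxi\<close> starts at time 0 whatever the state there, this needs the initial state to
  differ from \<open>r\<close>.\<close>

lemma filter_traj_xi:
  assumes "good \<omega>"
  shows "filter (\<lambda>i. i \<noteq> r) (traj (Suc (xi n \<omega>)) \<omega>) = map (\<lambda>k. Reta k \<omega>) [0..<Suc n]"
proof (induction n)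
  case 0
  then show ?case using assms by (simp add: good_def reta_def)
next
  case (Suc n)
  let ?a = "Suc (xi n \<omega>)" and ?b = "xi (Suc n) \<omega>"
  have "?a \<le> ?b" using xi_Suc(1)[OF assms] by (rule Suc_leI)
  then have "[0..<Suc ?b] = [0..<?a] @ [?a..<?b] @ [?b]"
    by (metis append.assoc le0 le_add_diff_inverse upt_Suc_append upt_add_eq_append)
  moreover have "filter (\<lambda>i. i \<noteq> r) (map (\<lambda>k. eta k \<omega>) [?a..<?b]) = []"
    using xi_Suc(3)[OF assms, of n] by (simp add: filter_empty_conv Suc_le_eq del: rxi.simps)
  moreover have "[0..<Suc (Suc n)] = [0..<Suc n] @ [Suc n]" by simp
  ultimately show ?case
    using Suc eta_xi[OF assms, of "Suc n"] by (simp add: reta_def del: rxi.simps upt_Suc)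
qed

definition Rcyl :: "nat list \<Rightarrow> 'a set" where
  "Rcyl v = {\<omega>\<in>space M. \<forall>k<length v. Reta k \<omega> = v ! k}"

text \<open>The trajectories of the original chain that reduce to v at a time when it is outside r.\<close>
definition histories :: "nat list \<Rightarrow> nat list set" where
  "histories v = {w. filter (\<lambda>i. i \<noteq> r) w = v \<and> last w \<noteq> r}"

text \<open>The point is uniqueness: the requirement \<open>last w \<noteq> r\<close> fixes where
  the trajectory is cut, so a good path in \<open>Rcyl v\<close> lies in the cylinder of exactly one
  history.\<close>

lemma histories_cyl_iff:
  assumes "good \<omega>" "v \<noteq> []"
  shows "w \<in> histories v \<and> \<omega> \<in> cyl w \<longleftrightarrow> \<omega> \<in> Rcyl v \<and> w = traj (Suc (xi (length v - 1) \<omega>)) \<omega>"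
proof
  assume a: "w \<in> histories v \<and> \<omega> \<in> cyl w"
  then obtain m where w: "w = traj m \<omega>" and sp: "\<omega> \<in> space M"
    unfolding cyl_iff_traj by blast
  have "w \<noteq> []" using a assms(2) by (auto simp: histories_def)
  then obtain m' where m': "m = Suc m'" using w by (cases m) auto
  then have "last w = eta m' \<omega>" using w by simp
  then obtain n where "xi n \<omega> = m'"
    using a visit_in_range_xi[OF assms(1)] by (auto simp: histories_def)
  with m' have n: "m = Suc (xi n \<omega>)" by simp
  then have v: "v = map (\<lambda>k. Reta k \<omega>) [0..<Suc n]"
    using filter_traj_xi[OF assms(1), of n] a unfolding w n histories_def by simp
  then have "length v = Suc n" by simp
  then show "\<omega> \<in> Rcyl v \<and> w = traj (Suc (xi (length v - 1) \<omega>)) \<omega>"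
    using w n v sp by (auto simp: Rcyl_def nth_append simp del: upt_Suc)
next
  assume a: "\<omega> \<in> Rcyl v \<and> w = traj (Suc (xi (length v - 1) \<omega>)) \<omega>"
  have "v = map (\<lambda>k. Reta k \<omega>) [0..<length v]"
    using a by (intro nth_equalityI) (simp_all add: Rcyl_def)
  then have "filter (\<lambda>i. i \<noteq> r) w = v"
    using filter_traj_xi[OF assms(1), of "length v - 1"] a assms(2) by (simp del: upt_Suc)
  moreover have "last w \<noteq> r"
    using a eta_xi[OF assms(1)] by simp
  moreover have "\<omega> \<in> cyl w"
    using a traj_in_cyl by (simp add: Rcyl_def del: upt_Suc)
  ultimately show "w \<in> histories v \<and> \<omega> \<in> cyl w" by (simp add: histories_def)
qed

end

subsection \<open>Excursions through r\<close>

context state_removal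
begin

lemma histories_snoc:
  assumes "w \<in> histories v" "j \<noteq> r"
  shows "w @ replicate q r @ [j] \<in> histories (v @ [j])"
  using assms by (auto simp: histories_def filter_empty_conv)

lemma histories_nonempty: "w \<in> histories v \<Longrightarrow> v \<noteq> [] \<Longrightarrow> w \<noteq> []"
  by (auto simp: histories_def)

lemma last_histories: "w \<in> histories v \<Longrightarrow> v \<noteq> [] \<Longrightarrow> last w = last v"
  by (cases w rule: rev_cases) (auto simp: histories_def)

lemma Rcyl_butlast: "Rcyl (v @ [j]) \<subseteq> Rcyl v"
  by (force simp: Rcyl_def nth_append)

text \<open>A path determines both the history and the number of visits to \<open>r\<close> that
  follow it, so the events indexed by (w, q) are disjoint on good paths.\<close>

lemma cyl_excursion_iff:
  assumes g: "good \<omega>" and v: "v \<noteq> []" and j: "j \<noteq> r" and w: "w \<in> histories v"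
  defines "n \<equiv> length v - 1"
  shows "\<omega> \<in> cyl (w @ replicate q r @ [j]) \<longleftrightarrow>
    \<omega> \<in> Rcyl (v @ [j]) \<and> w = traj (Suc (xi n \<omega>)) \<omega> \<and> q = xi (Suc n) \<omega> - Suc (xi n \<omega>)"
proof
  have n: "length (v @ [j]) - 1 = Suc n" using v by (simp add: n_def)
  note iff = histories_cyl_iff[OF g, of "v @ [j]", unfolded n]
  {
    assume a: "\<omega> \<in> cyl (w @ replicate q r @ [j])"
    have 1: "w = traj (Suc (xi n \<omega>)) \<omega>"
      using histories_cyl_iff[OF g v] a w cyl_append_subset unfolding n_def by blast
    \<comment> \<open>The extended list is itself a history, of \<open>v @ [j]\<close>, hence ends
      at the next visit outside \<open>r\<close>; comparing lengths then gives q.\<close>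
    have 2: "\<omega> \<in> Rcyl (v @ [j])" "w @ replicate q r @ [j] = traj (Suc (xi (Suc n) \<omega>)) \<omega>"
      using iff a histories_snoc[OF w j] by blast+
    have "length w + q = xi (Suc n) \<omega>"
      using arg_cong[OF 2(2), of length] by (simp del: rxi.simps)
    moreover have "length w = Suc (xi n \<omega>)" using arg_cong[OF 1, of length] by simp
    ultimately show "\<omega> \<in> Rcyl (v @ [j]) \<and> w = traj (Suc (xi n \<omega>)) \<omega> \<and> q = xi (Suc n) \<omega> - Suc (xi n \<omega>)"
      using 1 2(1) by simp
  }
  assume a: "\<omega> \<in> Rcyl (v @ [j]) \<and> w = traj (Suc (xi n \<omega>)) \<omega> \<and> q = xi (Suc n) \<omega> - Suc (xi n \<omega>)"
  let ?a = "Suc (xi n \<omega>)" and ?b = "xi (Suc n) \<omega>"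
  have "?a \<le> ?b" using xi_Suc(1)[OF g] by (rule Suc_leI)
  then have "[0..<Suc ?b] = [0..<?a] @ [?a..<?b] @ [?b]"
    by (metis append.assoc le0 le_add_diff_inverse upt_Suc_append upt_add_eq_append)
  moreover have "map (\<lambda>k. eta k \<omega>) [?a..<?b] = replicate q r"
    using a xi_Suc(3)[OF g, of n]
    by (intro nth_equalityI) (simp_all del: rxi.simps)
  moreover have "eta ?b \<omega> = j"
    using a v unfolding Rcyl_def reta_def n_def
    by (auto simp: nth_append simp del: rxi.simps)
  ultimately have "w @ replicate q r @ [j] = traj (Suc ?b) \<omega>"
    using a by (simp del: rxi.simps upt_Suc)
  then show "\<omega> \<in> cyl (w @ replicate q r @ [j])"
    using traj_in_cyl g by (metis good_def)
qed

text \<open>The disjoint union is expressed by counting measure so that it can be interchanged with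
  the expectation; exactly one summand is nonzero on \<open>Rcyl v\<close>.\<close>

lemma indicator_Rcyl:
  assumes g: "good \<omega>" and v: "v \<noteq> []"
  shows "indicator (Rcyl v) \<omega> = (\<integral>\<^sup>+w. indicator (cyl w) \<omega> \<partial>count_space (histories v))"
proof (cases "\<omega> \<in> Rcyl v")
  case True
  define w0 where "w0 = traj (Suc (xi (length v - 1) \<omega>)) \<omega>"
  have w0: "w0 \<in> histories v" 
    using histories_cyl_iff[OF g v] True unfolding w0_def by blast
  have "(\<integral>\<^sup>+w. indicator (cyl w) \<omega> \<partial>count_space (histories v))
     = (\<integral>\<^sup>+w. 1 * indicator {w0} w \<partial>count_space (histories v) :: ennreal)"
    using histories_cyl_iff[OF g v] True unfolding w0_def
    by (intro nn_integral_cong) (auto simp del: upt_Suc split: split_indicator)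
  also have "\<dots> = 1" using w0 by (subst nn_integral_indicator_singleton) auto
  finally show ?thesis using True by simp
next
  case False
  have "(\<integral>\<^sup>+w. indicator (cyl w) \<omega> \<partial>count_space (histories v))
     = (\<integral>\<^sup>+w. 0 \<partial>count_space (histories v) :: ennreal)"
    using histories_cyl_iff[OF g v] False
    by (intro nn_integral_cong) (auto simp del: upt_Suc split: split_indicator)
  then show ?thesis using False by simp
qed

text \<open>A general \<open>F\<close> lets one decomposition serve twice: the constant 1 yields
  probabilities, \<open>ennreal\<close> yields mean durations.\<close>

lemma Rkappa_indicator_Rcyl:
  fixes F :: "real \<Rightarrow> ennreal"
  assumes g: "good \<omega>" and v: "v \<noteq> []" and j: "j \<noteq> r"
  shows "F (Rkappa (length v) \<omega>) * indicator (Rcyl (v @ [j])) \<omega> =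
    (\<integral>\<^sup>+w. \<integral>\<^sup>+q. F (\<Sum>k\<in>{length w..length w + q}. kappa k \<omega>)
        * indicator (cyl (w @ replicate q r @ [j])) \<omega>
      \<partial>count_space UNIV \<partial>count_space (histories v))" (is "?L = ?R")
proof -
  define n where "n = length v - 1"
  define w0 where "w0 = traj (Suc (xi n \<omega>)) \<omega>"
  define q0 where "q0 = xi (Suc n) \<omega> - Suc (xi n \<omega>)"
  note iff = cyl_excursion_iff[OF g v j, folded n_def, folded w0_def q0_def]
  have len: "length v = Suc n" using v by (simp add: n_def)
  show ?thesis
  proof (cases "\<omega> \<in> Rcyl (v @ [j])")
    case True
    then have "\<omega> \<in> Rcyl v" using Rcyl_butlast by blast
    then have w0: "w0 \<in> histories v" 
      using histories_cyl_iff[OF g v] unfolding w0_def n_def by blast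
    have "?R = (\<integral>\<^sup>+w. \<integral>\<^sup>+q. F (\<Sum>k\<in>{length w..length w + q}. kappa k \<omega>) * indicator {q0} q
         * indicator {w0} w \<partial>count_space UNIV \<partial>count_space (histories v))"
      using iff True by (intro nn_integral_cong) (auto split: split_indicator)
    also have "\<dots> = (\<integral>\<^sup>+w. (\<integral>\<^sup>+q. F (\<Sum>k\<in>{length w..length w + q}. kappa k \<omega>) * indicator {q0} q
         \<partial>count_space UNIV) * indicator {w0} w \<partial>count_space (histories v))"
      by (intro nn_integral_cong nn_integral_multc) simp
    also have "\<dots> = F (\<Sum>k\<in>{length w0..length w0 + q0}. kappa k \<omega>)"
      using w0 by (subst nn_integral_indicator_singleton; simp)+
    \<comment> \<open>\<open>w0\<close> occupies the times 0 to \<open>xi n \<omega>\<close>, so the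
      first sojourn time of the new reduced step has index \<open>length w0\<close>.\<close>
    also have "{length w0..length w0 + q0} = {Suc (xi n \<omega>)..xi (Suc n) \<omega>}"
      using xi_Suc(1)[OF g, of n] by (simp add: w0_def q0_def del: rxi.simps)
    finally show ?thesis using True by (simp add: rkappa_def len del: rxi.simps)
  next
    case False
    have "?R = (\<integral>\<^sup>+w. 0 \<partial>count_space (histories v))"
      using iff False by (intro nn_integral_cong) auto
    then show ?thesis using False by simp
  qed
qed

lemma Rkappa_pos: "good \<omega> \<Longrightarrow> 0 < Rkappa (Suc n) \<omega>"
  using xi_Suc(1)[of \<omega> n]
  by (auto simp: rkappa_def good_def simp del: rxi.simps intro!: sum_pos)

text \<open>The probability (mass) and the mean duration restricted to the event (mean) of a passage
  from i to j along i, r, ..., r, j with r occurring exactly q times.\<close>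
definition mass :: "nat \<Rightarrow> nat \<Rightarrow> nat \<Rightarrow> real" where
  "mass i j q = (case q of 0 \<Rightarrow> kp Q i j | Suc q' \<Rightarrow> kp Q i r * kp Q r r ^ q' * kp Q r j)"

text \<open>Mean duration of i, r, ..., r with r occurring q + 1 times; the factor real q hides the
  truncation of q - 1 at q = 0.\<close>
definition mean_in_r :: "nat \<Rightarrow> nat \<Rightarrow> real" where
  "mean_in_r i q = ke Q i r * kp Q r r ^ q + kp Q i r * ke Q r r * (real q * kp Q r r ^ (q - 1))"

text \<open>A Leibniz rule: the factors \<open>kp\<close> of \<open>mass i j q\<close> are replaced
  by \<open>ke\<close> one at a time, all but the last being collected in
  \<open>mean_in_r\<close>.\<close>

definition mean :: "nat \<Rightarrow> nat \<Rightarrow> nat \<Rightarrow> real" where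
  "mean i j q = (case q of 0 \<Rightarrow> ke Q i j
     | Suc q' \<Rightarrow> mean_in_r i q' * kp Q r j + kp Q i r * kp Q r r ^ q' * ke Q r j)"

lemma ke_ext_eq: "i \<in> X \<Longrightarrow> j \<in> X \<Longrightarrow> ke_ext Q i j = ennreal (ke Q i j)"
  using finite_mean by (simp add: ke_def)

lemma ke_nonneg: "0 \<le> ke Q i j"
  by (simp add: ke_def)

lemma measure_excursion:
  assumes "w \<noteq> []" "last w \<in> X" "j \<in> X"
  shows "measure M (cyl (w @ replicate q r @ [j])) = measure M (cyl w) * mass (last w) j q"
proof (cases q)
  case 0
  then show ?thesis using measure_cyl_snoc[OF assms] by (simp add: mass_def)
next
  case (Suc q')
  have "measure M (cyl ((w @ replicate q r) @ [j])) = measure M (cyl (w @ replicate q r)) * kp Q r j"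
    using measure_cyl_snoc[of "w @ replicate q r" j] assms r_in Suc by simp
  then show ?thesis
    using measure_cyl_replicate[OF assms(1,2), of q'] unfolding Suc
    by (simp add: mass_def del: replicate_Suc)
qed

text \<open>A sum of separate expectations, so that each sojourn time can be followed individually.
  The times belonging to \<open>w\<close> are left out because they are part of earlier reduced
  steps.\<close>

definition time_after :: "nat list \<Rightarrow> nat list \<Rightarrow> ennreal" where
  "time_after w u = (\<Sum>k\<in>{length w..<length w + length u}. \<integral>\<^sup>+\<omega>\<in>cyl (w @ u). ennreal (kappa k \<omega>) \<partial>M)"

text \<open>One step of the Leibniz rule: the old times pick up the factor \<open>kp\<close>, and
  the new time contributes its own mean.\<close>

lemma time_after_snoc:
  assumes "w \<noteq> []" "last (w @ u) \<in> X" "y \<in> X"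
  shows "time_after w (u @ [y]) = ennreal (kp Q (last (w @ u)) y) * time_after w u
      + ennreal (measure M (cyl (w @ u)) * ke Q (last (w @ u)) y)"
proof -
  have pos: "1 \<le> k" if "length w \<le> k" for k using assms(1) that by (cases w) auto
  have "time_after w (u @ [y])
    = (\<Sum>k\<in>{length w..<length w + length u}. \<integral>\<^sup>+\<omega>\<in>cyl ((w @ u) @ [y]). ennreal (kappa k \<omega>) \<partial>M)
      + (\<integral>\<^sup>+\<omega>\<in>cyl ((w @ u) @ [y]). ennreal (kappa (length (w @ u)) \<omega>) \<partial>M)"
    by (simp add: time_after_def)
  also have "(\<integral>\<^sup>+\<omega>\<in>cyl ((w @ u) @ [y]). ennreal (kappa (length (w @ u)) \<omega>) \<partial>M)
    = ennreal (measure M (cyl (w @ u)) * ke Q (last (w @ u)) y)"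
    using nn_integral_cyl_snoc[of "w @ u" y] assms by (simp add: ke_ext_eq ennreal_mult ke_nonneg)
  also have "(\<Sum>k\<in>{length w..<length w + length u}. \<integral>\<^sup>+\<omega>\<in>cyl ((w @ u) @ [y]). ennreal (kappa k \<omega>) \<partial>M)
    = (\<Sum>k\<in>{length w..<length w + length u}. ennreal (kp Q (last (w @ u)) y)
        * (\<integral>\<^sup>+\<omega>\<in>cyl (w @ u). ennreal (kappa k \<omega>) \<partial>M))"
    using assms pos by (intro sum.cong nn_integral_cyl_snoc_earlier) auto
  finally show ?thesis by (simp add: time_after_def sum_distrib_left)
qed

lemma time_after_replicate:
  assumes "w \<noteq> []" "last w \<in> X"
  shows "time_after w (replicate (Suc q) r) = ennreal (measure M (cyl w) * mean_in_r (last w) q)"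
proof (induction q)
  case 0
  have "time_after w [] = 0" by (simp add: time_after_def)
  then show ?case
    using time_after_snoc[of w "[]" r] assms r_in by (simp add: mean_in_r_def)
next
  case (Suc q)
  define u where "u = replicate (Suc q) r"
  have "time_after w (replicate (Suc (Suc q)) r) = time_after w (u @ [r])"
    unfolding u_def replicate_append_same by simp
  also have "\<dots> = ennreal (kp Q r r) * time_after w u + ennreal (measure M (cyl (w @ u)) * ke Q r r)"
    using time_after_snoc[of w u r] assms(1) r_in by (simp add: u_def)
  also have "\<dots> = ennreal (kp Q r r * (measure M (cyl w) * mean_in_r (last w) q)
      + measure M (cyl w) * kp Q (last w) r * kp Q r r ^ q * ke Q r r)"
    using Suc measure_cyl_replicate[OF assms, of q] unfolding u_def
    by (simp add: ennreal_mult ennreal_plus kp_nonneg ke_nonneg mean_in_r_def del: replicate_Suc)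
  \<comment> \<open>With x = \<open>kp Q r r\<close> this is x * (q * x^(q-1)) + x^q = (q+1) * x^q;
    the case split on q deals with the truncated exponent.\<close>
  also have "kp Q r r * (measure M (cyl w) * mean_in_r (last w) q)
      + measure M (cyl w) * kp Q (last w) r * kp Q r r ^ q * ke Q r r
      = measure M (cyl w) * mean_in_r (last w) (Suc q)"
    by (cases q) (simp_all add: mean_in_r_def algebra_simps)
  finally show ?case .
qed

lemma mean_in_r_nonneg: "0 \<le> mean_in_r i q"
  by (simp add: mean_in_r_def kp_nonneg ke_nonneg)

lemma time_after_excursion:
  assumes "w \<noteq> []" "last w \<in> X" "j \<in> X"
  shows "time_after w (replicate q r @ [j]) = ennreal (measure M (cyl w) * mean (last w) j q)"
proof (cases q)
  case 0
  have "time_after w [] = 0" by (simp add: time_after_def)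
  then show ?thesis
    using time_after_snoc[of w "[]" j] assms 0 by (simp add: mean_def)
next
  case (Suc q')
  have "time_after w (replicate q r @ [j]) = ennreal (kp Q r j) * time_after w (replicate q r)
      + ennreal (measure M (cyl (w @ replicate q r)) * ke Q r j)"
    using time_after_snoc[of w "replicate q r" j] assms r_in Suc by simp
  also have "\<dots> = ennreal (measure M (cyl w) * mean (last w) j q)"
    unfolding Suc time_after_replicate[OF assms(1,2)] measure_cyl_replicate[OF assms(1,2)]
    by (simp add: mean_def ennreal_mult[symmetric] ennreal_plus[symmetric] kp_nonneg ke_nonneg
        mean_in_r_nonneg algebra_simps del: ennreal_plus)
  finally show ?thesis .
qed

lemma nn_integral_excursion:
  assumes "w \<noteq> []" "last w \<in> X" "j \<in> X"
  shows "(\<integral>\<^sup>+\<omega>\<in>cyl (w @ replicate q r @ [j]). ennreal (\<Sum>k\<in>{length w..length w + q}. kappa k \<omega>) \<partial>M)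
    = ennreal (measure M (cyl w) * mean (last w) j q)"
proof -
  have "(\<integral>\<^sup>+\<omega>\<in>cyl (w @ replicate q r @ [j]). ennreal (\<Sum>k\<in>{length w..length w + q}. kappa k \<omega>) \<partial>M)
    = (\<integral>\<^sup>+\<omega>. (\<Sum>k\<in>{length w..length w + q}. ennreal (kappa k \<omega>) * indicator (cyl (w @ replicate q r @ [j])) \<omega>) \<partial>M)"
  \<comment> \<open>\<open>ennreal\<close> sends negative reals to 0, so it is distributed over the
    sum only where all sojourn times are positive.\<close>
  proof (rule nn_integral_cong_AE)
    show "AE \<omega> in M. ennreal (\<Sum>k\<in>{length w..length w + q}. kappa k \<omega>) * indicator (cyl (w @ replicate q r @ [j])) \<omega>
      = (\<Sum>k\<in>{length w..length w + q}. ennreal (kappa k \<omega>) * indicator (cyl (w @ replicate q r @ [j])) \<omega>)"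
      using AE_kappa_pos
    proof eventually_elim
      case (elim \<omega>)
      have "1 \<le> k" if "length w \<le> k" for k using assms(1) that by (cases w) auto
      then have "(\<Sum>k\<in>{length w..length w + q}. ennreal (kappa k \<omega>)) = ennreal (\<Sum>k\<in>{length w..length w + q}. kappa k \<omega>)"
        using elim by (intro sum_ennreal) (auto intro: less_imp_le)
      then show ?case unfolding sum_distrib_right[symmetric] by simp
    qed
  qed
  also have "\<dots> = time_after w (replicate q r @ [j])"
    by (subst nn_integral_sum) (auto simp: time_after_def atLeastLessThanSuc_atLeastAtMost)
  finally show ?thesis using time_after_excursion[OF assms] by simp
qed

section \<open>Series over the number of visits to r\<close>

lemma mass_sums: "mass i j sums (kp Q i j + kp Q i r * kp Q r j / (1 - kp Q r r))"
proof -
  have "(\<lambda>q. kp Q r r ^ q) sums (1 / (1 - kp Q r r))"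
    using not_absorbing kp_nonneg by (intro geometric_sums) simp
  then have "(\<lambda>q. kp Q i r * kp Q r j * kp Q r r ^ q) sums (kp Q i r * kp Q r j * (1 / (1 - kp Q r r)))"
    by (rule sums_mult)
  then have "(\<lambda>q. mass i j (Suc q)) sums (kp Q i r * kp Q r j / (1 - kp Q r r))"
    by (simp add: mass_def mult_ac)
  from sums_Suc[OF this] show ?thesis
    by (simp add: mass_def[of i j 0] add_ac)
qed

lemma mean_sums:
  "mean i j sums (ke Q i j + (ke Q i r * kp Q r j + kp Q i r * ke Q r j) / (1 - kp Q r r)
     + kp Q i r * ke Q r r * kp Q r j / (1 - kp Q r r)\<^sup>2)"
proof -
  let ?x = "kp Q r r"
  have x: "norm ?x < 1" using not_absorbing kp_nonneg by simp
  have 1: "(\<lambda>q. ?x ^ q) sums (1 / (1 - ?x))"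
    using x by (rule geometric_sums)
  \<comment> \<open>The differentiated geometric series; prepending its vanishing term at 0 gives
    the indexing used in \<open>mean_in_r\<close>.\<close>
  have "(\<lambda>q. real (Suc q) * ?x ^ (Suc q - 1)) sums (1 / (1 - ?x)\<^sup>2)"
    using geometric_deriv_sums[OF x] by simp
  from sums_Suc[OF this] have 2: "(\<lambda>q. real q * ?x ^ (q - 1)) sums (1 / (1 - ?x)\<^sup>2)" by simp
  have "(\<lambda>q. (ke Q i r * kp Q r j + kp Q i r * ke Q r j) * ?x ^ q
      + kp Q i r * ke Q r r * kp Q r j * (real q * ?x ^ (q - 1)))
    sums ((ke Q i r * kp Q r j + kp Q i r * ke Q r j) * (1 / (1 - ?x))
      + kp Q i r * ke Q r r * kp Q r j * (1 / (1 - ?x)\<^sup>2))"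
    by (intro sums_add sums_mult 1 2)
  moreover have "mean i j (Suc q) = (ke Q i r * kp Q r j + kp Q i r * ke Q r j) * ?x ^ q
      + kp Q i r * ke Q r r * kp Q r j * (real q * ?x ^ (q - 1))" for q
    by (simp add: mean_def mean_in_r_def algebra_simps)
  ultimately have "(\<lambda>q. mean i j (Suc q)) sums ((ke Q i r * kp Q r j + kp Q i r * ke Q r j) / (1 - ?x)
      + kp Q i r * ke Q r r * kp Q r j / (1 - ?x)\<^sup>2)"
    by (simp only: times_divide_eq_right mult_1_right)
  from sums_Suc[OF this] show ?thesis
    by (simp add: mean_def[of i j 0] add_ac)
qed

end

subsection \<open>Transition characteristics of the reduced process\<close>

text \<open>Both processes live on the same space \<open>M\<close>, so the same event can be
  measured by excursions of the original chain and by the law of the reduced one.\<close>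

locale reduced_renewal = state_removal X M eta kappa Q r
    + R: markov_renewal "X - {r}" M "reta (X - {r}) eta" "rkappa (X - {r}) eta kappa" rQ
  for X :: "nat set" and M :: "'a measure" and eta kappa Q r rQ
begin

lemma Rcyl_eq: "Rcyl v = R.cyl v"
  by (simp add: Rcyl_def R.cyl_def)

lemma Rcyl_sets [measurable]: "Rcyl v \<in> sets M"
  unfolding Rcyl_eq by (rule R.cyl_sets)

lemma emeasure_Rcyl:
  assumes "v \<noteq> []"
  shows "emeasure M (Rcyl v) = (\<integral>\<^sup>+w. emeasure M (cyl w) \<partial>count_space (histories v))"
proof -
  have "emeasure M (Rcyl v) = (\<integral>\<^sup>+\<omega>. indicator (Rcyl v) \<omega> \<partial>M)" by simp
  also have "\<dots> = (\<integral>\<^sup>+\<omega>. \<integral>\<^sup>+w. indicator (cyl w) \<omega> \<partial>count_space (histories v) \<partial>M)"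
    using AE_good by (intro nn_integral_cong_AE) (elim eventually_mono, rule indicator_Rcyl[OF _ assms])
  also have "\<dots> = (\<integral>\<^sup>+w. \<integral>\<^sup>+\<omega>. indicator (cyl w) \<omega> \<partial>M \<partial>count_space (histories v))"
    by (intro nn_integral_count_space_nn_integral) auto
  finally show ?thesis by simp
qed

text \<open>The weight \<open>c q\<close> depends on the history only through its last state, which
  is \<open>last v\<close> for all histories of \<open>v\<close>. So the sum over q factors out, and
  the sum over histories reassembles the probability of \<open>Rcyl v\<close>.\<close>

lemma nn_integral_Rcyl_snoc:
  fixes F :: "real \<Rightarrow> ennreal"
  assumes v: "v \<noteq> []" "last v \<in> X" and j: "j \<in> X" "j \<noteq> r"
    and F [measurable]: "F \<in> borel_measurable borel"
    and c: "\<And>w q. w \<noteq> [] \<Longrightarrow> last w = last v \<Longrightarrow>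
      (\<integral>\<^sup>+\<omega>\<in>cyl (w @ replicate q r @ [j]). F (\<Sum>k\<in>{length w..length w + q}. kappa k \<omega>) \<partial>M)
        = ennreal (measure M (cyl w) * c q)"
    and c0: "\<And>q. 0 \<le> c q" and s: "c sums s"
  shows "(\<integral>\<^sup>+\<omega>\<in>Rcyl (v @ [j]). F (Rkappa (length v) \<omega>) \<partial>M) = ennreal (measure M (Rcyl v) * s)"
proof -
  have s0: "0 \<le> s" using s c0 by (metis sums_le sums_zero)
  let ?f = "\<lambda>w q \<omega>. F (\<Sum>k\<in>{length w..length w + q}. kappa k \<omega>) * indicator (cyl (w @ replicate q r @ [j])) \<omega>"
  have "(\<integral>\<^sup>+\<omega>\<in>Rcyl (v @ [j]). F (Rkappa (length v) \<omega>) \<partial>M)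
    = (\<integral>\<^sup>+\<omega>. \<integral>\<^sup>+w. \<integral>\<^sup>+q. ?f w q \<omega> \<partial>count_space UNIV \<partial>count_space (histories v) \<partial>M)"
    using AE_good by (intro nn_integral_cong_AE)
      (elim eventually_mono, rule Rkappa_indicator_Rcyl[OF _ v(1) j(2)])
  also have "\<dots> = (\<integral>\<^sup>+w. \<integral>\<^sup>+\<omega>. \<integral>\<^sup>+q. ?f w q \<omega> \<partial>count_space UNIV \<partial>M \<partial>count_space (histories v))"
    \<comment> \<open>Written as a series, the inner integral is measurable in
      \<open>\<omega>\<close>, as the interchange requires.\<close>
    unfolding nn_integral_count_space_nat
    by (intro nn_integral_count_space_nn_integral) auto
  also have "\<dots> = (\<integral>\<^sup>+w. \<integral>\<^sup>+q. \<integral>\<^sup>+\<omega>. ?f w q \<omega> \<partial>M \<partial>count_space UNIV \<partial>count_space (histories v))"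
    by (intro nn_integral_cong nn_integral_count_space_nn_integral) auto
  also have "\<dots> = (\<integral>\<^sup>+w. ennreal s * emeasure M (cyl w) \<partial>count_space (histories v))"
  proof (intro nn_integral_cong)
    fix w assume "w \<in> space (count_space (histories v))"
    then have w: "w \<noteq> []" "last w = last v"
      using histories_nonempty last_histories v by auto
    have "(\<integral>\<^sup>+q. \<integral>\<^sup>+\<omega>. ?f w q \<omega> \<partial>M \<partial>count_space UNIV) = (\<Sum>q. ennreal (measure M (cyl w) * c q))"
      by (simp add: c[OF w] nn_integral_count_space_nat)
    also have "\<dots> = ennreal (measure M (cyl w) * s)"
      using s c0 by (intro suminf_ennreal_eq sums_mult) auto
    finally show "(\<integral>\<^sup>+q. \<integral>\<^sup>+\<omega>. ?f w q \<omega> \<partial>M \<partial>count_space UNIV) = ennreal s * emeasure M (cyl w)"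
      using s0 by (simp add: emeasure_eq_measure ennreal_mult mult.commute)
  qed
  also have "\<dots> = ennreal s * emeasure M (Rcyl v)"
    unfolding emeasure_Rcyl[OF v(1)] by (rule nn_integral_cmult) simp
  finally show ?thesis using s0 by (simp add: emeasure_eq_measure ennreal_mult mult.commute)
qed

context
  fixes i j w
  assumes ij: "i \<in> X - {r}" "j \<in> X - {r}"
    and w: "w \<noteq> []" "last w = i" "0 < measure M (cyl w)"
begin

text \<open>Supplies the positive factor that is later cancelled: deleting \<open>r\<close> from
  \<open>w\<close> can only enlarge the event, up to a null set.\<close>

lemma positive_history: "\<exists>v. v \<noteq> [] \<and> last v = i \<and> 0 < measure M (Rcyl v)"
proof (intro exI conjI)
  let ?v = "filter (\<lambda>i. i \<noteq> r) w"
  have "w \<in> histories ?v" using w ij by (simp add: histories_def)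
  show "?v \<noteq> []" using w ij by (auto simp: filter_empty_conv dest: last_in_set)
  then show "last ?v = i" using last_histories[OF \<open>w \<in> histories ?v\<close>] w by simp
  have "measure M (cyl w) \<le> measure M (Rcyl ?v)"
  proof (rule finite_measure_mono_AE)
    show "AE \<omega> in M. \<omega> \<in> cyl w \<longrightarrow> \<omega> \<in> Rcyl ?v"
      using AE_good
    proof eventually_elim
      case (elim \<omega>)
      show ?case
        using histories_cyl_iff[OF elim \<open>?v \<noteq> []\<close>, of w] \<open>w \<in> histories ?v\<close> by blast
    qed
  qed simp
  with w show "0 < measure M (Rcyl ?v)" by simp
qed

lemma kp_reduced: "kp rQ i j = kp Q i j + kp Q i r * kp Q r j / (1 - kp Q r r)" (is "_ = ?s")
proof -
  obtain v where v: "v \<noteq> []" "last v = i" "0 < measure M (Rcyl v)"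
    using positive_history by blast
  have s0: "0 \<le> ?s" using kp_nonneg not_absorbing by simp
  have "emeasure M (Rcyl (v @ [j])) = (\<integral>\<^sup>+\<omega>\<in>Rcyl (v @ [j]). 1 \<partial>M)" by simp
  also have "\<dots> = ennreal (measure M (Rcyl v) * ?s)"
    using v ij
    by (intro nn_integral_Rcyl_snoc[where c="mass i j" and F="\<lambda>_. 1"] mass_sums)
       (auto simp: measure_excursion emeasure_eq_measure mass_def kp_nonneg split: nat.split)
  finally have "measure M (Rcyl (v @ [j])) = measure M (Rcyl v) * ?s"
    using s0 by (simp add: emeasure_eq_measure)
  moreover have "measure M (Rcyl (v @ [j])) = measure M (Rcyl v) * kp rQ i j"
    using R.measure_cyl_snoc[of v j] v ij unfolding Rcyl_eq by simp
  ultimately show ?thesis using v(3) by simp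
qed

lemma ke_ext_reduced: "ke_ext rQ i j = ennreal (ke Q i j
     + (ke Q i r * kp Q r j + kp Q i r * ke Q r j) / (1 - kp Q r r)
     + kp Q i r * ke Q r r * kp Q r j / (1 - kp Q r r)\<^sup>2)" (is "_ = ennreal ?s")
proof -
  obtain v where v: "v \<noteq> []" "last v = i" "0 < measure M (Rcyl v)"
    using positive_history by blast
  have s0: "0 \<le> ?s" using kp_nonneg ke_nonneg not_absorbing by simp
  have "(\<integral>\<^sup>+\<omega>\<in>Rcyl (v @ [j]). ennreal (Rkappa (length v) \<omega>) \<partial>M) = ennreal (measure M (Rcyl v) * ?s)"
    using v ij
    by (intro nn_integral_Rcyl_snoc[where c="mean i j" and F="ennreal"] mean_sums)
       (auto simp: nn_integral_excursion mean_def kp_nonneg ke_nonneg mean_in_r_nonneg split: nat.split)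
  moreover have "(\<integral>\<^sup>+\<omega>\<in>Rcyl (v @ [j]). ennreal (Rkappa (length v) \<omega>) \<partial>M)
      = ennreal (measure M (Rcyl v)) * ke_ext rQ i j"
    using R.nn_integral_cyl_snoc[of v j] v ij unfolding Rcyl_eq by simp
  ultimately have "ennreal (measure M (Rcyl v)) * ke_ext rQ i j = ennreal (measure M (Rcyl v)) * ennreal ?s"
    using s0 by (simp add: ennreal_mult)
  then show ?thesis
    using v(3) by (subst (asm) ennreal_mult_cancel_left) auto
qed

text \<open>A reduced duration is a nonempty sum of positive sojourn times on good paths, so the
  event is null although its history has positive probability.\<close>

lemma kcdf_reduced_0: "kcdf rQ i j 0 = 0"
proof -
  obtain v where v: "v \<noteq> []" "last v = i" "0 < measure M (Rcyl v)"
    using positive_history by blast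
  let ?Z = "R.cyl (v @ [j]) \<inter> {\<omega>\<in>space M. Rkappa (length v) \<omega> \<le> 0}"
  have "AE \<omega> in M. \<omega> \<notin> ?Z"
    using AE_good
  proof eventually_elim
    case (elim \<omega>)
    then have "0 < Rkappa (length v) \<omega>" using Rkappa_pos[OF elim, of "length v - 1"] v(1) by simp
    then show ?case by simp
  qed
  then have "measure M ?Z = 0"
    by (intro measure_eq_0_null_sets) (simp add: AE_iff_null_sets)
  then show ?thesis
    using R.measure_cyl_snoc_le[of v j 0] v ij unfolding Rcyl_eq by simp
qed

end

end

subsection \<open>Pivotal expansions\<close>

text \<open>An (h, k)-expansion can be truncated to an (h, h)-expansion, so only the leading term
  matters.\<close>
definition pivotal :: "(real \<Rightarrow> real) \<Rightarrow> bool" where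
  "pivotal A \<longleftrightarrow> (\<exists>h::int. \<exists>c>0. ((\<lambda>e. A e / e powi h) \<longlongrightarrow> c) (at_right 0))"

text \<open>Needed because entries outside the transition sets are zero: unlike
  \<open>pivotal\<close>, this class contains them and is still closed under sums, products and
  division by pivotal functions.\<close>

definition pivotal_or_0 :: "(real \<Rightarrow> real) \<Rightarrow> bool" where
  "pivotal_or_0 A \<longleftrightarrow> pivotal A \<or> (\<forall>\<^sub>F e in at_right 0. A e = 0)"

lemma eventually_pos_at_right: "\<forall>\<^sub>F e::real in at_right 0. 0 < e"
  by (simp add: eventually_at_filter)

lemma powi_tendsto:
  assumes "0 \<le> k"
  shows "((\<lambda>e::real. e powi k) \<longlongrightarrow> (if k = 0 then 1 else 0)) (at_right 0)"
proof -
  obtain n where n: "k = int n" using assms nonneg_int_cases by blast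
  have "((\<lambda>e::real. e ^ n) \<longlongrightarrow> 0 ^ n) (at_right 0)"
    by (intro tendsto_intros)
  then show ?thesis by (simp add: n power_0_left)
qed

text \<open>The exponent map \<open>f\<close> covers D and E together: it is \<open>int\<close> for
  natural exponents and the identity for integer ones. After division by the lowest power every
  other term tends to 0.\<close>

lemma pivotal_expansion:
  fixes f :: "'i \<Rightarrow> int"
  assumes I: "finite I" "l0 \<in> I" and f: "\<And>l. l \<in> I \<Longrightarrow> l \<noteq> l0 \<Longrightarrow> f l0 < f l" and m: "f l0 \<le> m"
    and b: "0 < b l0" and "0 < eps0"
    and A: "\<And>e. e \<in> {0<..eps0} \<Longrightarrow> A e = (\<Sum>l\<in>I. b l * e powi f l) + rem e"
    and rem: "((\<lambda>e. rem e / e powi m) \<longlongrightarrow> 0) (at_right 0)"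
  shows "pivotal A"
proof -
  let ?h = "f l0"
  have "((\<lambda>e. (\<Sum>l\<in>I. b l * e powi (f l - ?h)) + rem e / e powi m * e powi (m - ?h))
      \<longlongrightarrow> (\<Sum>l\<in>I. b l * (if f l - ?h = 0 then 1 else 0)) + 0 * (if m - ?h = 0 then 1 else 0)) (at_right 0)"
    using I f m
    by (intro tendsto_intros powi_tendsto rem) (force intro: less_imp_le)+
  also have "(\<Sum>l\<in>I. b l * (if f l - ?h = 0 then 1 else 0)) = (\<Sum>l\<in>I. if l = l0 then b l0 else 0)"
  proof (intro sum.cong refl)
    fix l assume "l \<in> I"
    with f[of l] show "b l * (if f l - ?h = 0 then 1 else 0) = (if l = l0 then b l0 else 0)"
      by (cases "l = l0") auto
  qed
  also have "\<dots> = b l0" using I by simp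
  finally have lim: "((\<lambda>e. (\<Sum>l\<in>I. b l * e powi (f l - ?h)) + rem e / e powi m * e powi (m - ?h))
      \<longlongrightarrow> b l0) (at_right 0)" by simp
  have "\<forall>\<^sub>F e in at_right 0. e \<in> {0<..eps0}"
    using \<open>0 < eps0\<close> by (intro eventually_at_rightI[of 0 eps0]) auto
  then have "\<forall>\<^sub>F e in at_right 0. (\<Sum>l\<in>I. b l * e powi (f l - ?h)) + rem e / e powi m * e powi (m - ?h)
      = A e / e powi ?h"
    by eventually_elim (simp add: A add_divide_distrib sum_divide_distrib power_int_diff)
  from Lim_transform_eventually[OF lim this] b show ?thesis
    unfolding pivotal_def by blast
qed

lemma pivotal_eventually_pos:
  assumes "pivotal A"
  shows "\<forall>\<^sub>F e in at_right 0. 0 < A e"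
proof -
  obtain h c where c: "0 < c" and l: "((\<lambda>e. A e / e powi h) \<longlongrightarrow> c) (at_right 0)"
    using assms unfolding pivotal_def by blast
  from order_tendstoD(1)[OF l c] eventually_pos_at_right show ?thesis
  proof eventually_elim
    case (elim e)
    from elim(2) have "0 < e powi h" by (rule zero_less_power_int)
    with elim(1) show ?case by (simp add: zero_less_divide_iff)
  qed
qed

lemma pivotal_cong:
  assumes "pivotal A" "\<forall>\<^sub>F e in at_right 0. A e = B e"
  shows "pivotal B"
proof -
  obtain h c where c: "0 < c" and l: "((\<lambda>e. A e / e powi h) \<longlongrightarrow> c) (at_right 0)"
    using assms unfolding pivotal_def by blast
  have "\<forall>\<^sub>F e in at_right 0. A e / e powi h = B e / e powi h"
    using assms(2) by eventually_elim simp
  from Lim_transform_eventually[OF l this] c show ?thesis unfolding pivotal_def by blast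
qed

text \<open>The lower order dominates; for equal orders the leading coefficients add, and being
  positive they cannot cancel.\<close>

lemma pivotal_add:
  assumes "pivotal A" "pivotal B"
  shows "pivotal (\<lambda>e. A e + B e)"
proof -
  have *: "pivotal (\<lambda>e. A e + B e)"
    if c: "0 < c" and A: "((\<lambda>e. A e / e powi h) \<longlongrightarrow> c) (at_right 0)"
      and d: "0 < d" and B: "((\<lambda>e. B e / e powi k) \<longlongrightarrow> d) (at_right 0)" and "h \<le> k"
    for A B :: "real \<Rightarrow> real" and c d h k
  proof -
    have lim: "((\<lambda>e. A e / e powi h + B e / e powi k * e powi (k - h))
        \<longlongrightarrow> c + d * (if k - h = 0 then 1 else 0)) (at_right 0)"
      using \<open>h \<le> k\<close> by (intro tendsto_intros powi_tendsto A B) auto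
    have "\<forall>\<^sub>F e in at_right 0. A e / e powi h + B e / e powi k * e powi (k - h) = (A e + B e) / e powi h"
      using eventually_pos_at_right by eventually_elim (simp add: add_divide_distrib power_int_diff)
    from Lim_transform_eventually[OF lim this]
    have "((\<lambda>e. (A e + B e) / e powi h) \<longlongrightarrow> c + d * (if k - h = 0 then 1 else 0)) (at_right 0)" .
    moreover have "0 < c + d * (if k - h = 0 then 1 else 0)" using c d by simp
    ultimately show ?thesis unfolding pivotal_def by blast
  qed
  obtain h c k d where "0 < c" "((\<lambda>e. A e / e powi h) \<longlongrightarrow> c) (at_right 0)"
    "0 < d" "((\<lambda>e. B e / e powi k) \<longlongrightarrow> d) (at_right 0)"
    using assms unfolding pivotal_def by blast
  then show ?thesis
    using *[of c A h d B k] *[of d B k c A h] by (cases "h \<le> k") (simp_all add: add.commute)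
qed

lemma pivotal_mult:
  assumes "pivotal A" "pivotal B"
  shows "pivotal (\<lambda>e. A e * B e)"
proof -
  obtain h c k d where c: "0 < c" and A: "((\<lambda>e. A e / e powi h) \<longlongrightarrow> c) (at_right 0)"
    and d: "0 < d" and B: "((\<lambda>e. B e / e powi k) \<longlongrightarrow> d) (at_right 0)"
    using assms unfolding pivotal_def by blast
  have "\<forall>\<^sub>F e in at_right 0. A e / e powi h * (B e / e powi k) = A e * B e / e powi (h + k)"
    using eventually_pos_at_right by eventually_elim (simp add: power_int_add)
  from Lim_transform_eventually[OF tendsto_mult[OF A B] this] c d show ?thesis
    unfolding pivotal_def by (intro exI[of _ "h + k"] exI[of _ "c * d"]) simp
qed

lemma pivotal_inverse:
  assumes "pivotal A"
  shows "pivotal (\<lambda>e. inverse (A e))"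
proof -
  obtain h c where c: "0 < c" and A: "((\<lambda>e. A e / e powi h) \<longlongrightarrow> c) (at_right 0)"
    using assms unfolding pivotal_def by blast
  have eq: "inverse (A e / e powi h) = inverse (A e) / e powi (- h)" for e
    by (simp add: power_int_minus divide_inverse mult.commute)
  have "((\<lambda>e. inverse (A e / e powi h)) \<longlongrightarrow> inverse c) (at_right 0)"
    using c by (intro tendsto_inverse A) simp
  then show ?thesis
    using c unfolding pivotal_def eq by (intro exI[of _ "- h"] exI[of _ "inverse c"]) simp
qed

lemma pivotal_or_0_add:
  assumes "pivotal_or_0 A" "pivotal_or_0 B"
  shows "pivotal_or_0 (\<lambda>e. A e + B e)"
proof -
  consider "pivotal A" "pivotal B" | "pivotal A" "\<forall>\<^sub>F e in at_right 0. B e = 0"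
    | "pivotal B" "\<forall>\<^sub>F e in at_right 0. A e = 0"
    | "\<forall>\<^sub>F e in at_right 0. A e = 0" "\<forall>\<^sub>F e in at_right 0. B e = 0"
    using assms unfolding pivotal_or_0_def by blast
  then show ?thesis
  proof cases
    case 1
    then show ?thesis unfolding pivotal_or_0_def using pivotal_add by blast
  next
    case 2
    from 2(2) have "\<forall>\<^sub>F e in at_right 0. A e = A e + B e" by eventually_elim simp
    from pivotal_cong[OF 2(1) this] show ?thesis by (simp add: pivotal_or_0_def)
  next
    case 3
    from 3(2) have "\<forall>\<^sub>F e in at_right 0. B e = A e + B e" by eventually_elim simp
    from pivotal_cong[OF 3(1) this] show ?thesis by (simp add: pivotal_or_0_def)
  next
    case 4
    then have "\<forall>\<^sub>F e in at_right 0. A e + B e = 0" by eventually_elim simp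
    then show ?thesis unfolding pivotal_or_0_def by blast
  qed
qed

lemma pivotal_or_0_mult:
  assumes "pivotal_or_0 A" "pivotal_or_0 B"
  shows "pivotal_or_0 (\<lambda>e. A e * B e)"
proof -
  consider "pivotal A" "pivotal B" | "\<forall>\<^sub>F e in at_right 0. A e = 0" | "\<forall>\<^sub>F e in at_right 0. B e = 0"
    using assms unfolding pivotal_or_0_def by blast
  then show ?thesis
  proof cases
    case 1
    then show ?thesis unfolding pivotal_or_0_def using pivotal_mult by blast
  next
    case 2
    then have "\<forall>\<^sub>F e in at_right 0. A e * B e = 0" by eventually_elim simp
    then show ?thesis unfolding pivotal_or_0_def by blast
  next
    case 3
    then have "\<forall>\<^sub>F e in at_right 0. A e * B e = 0" by eventually_elim simp
    then show ?thesis unfolding pivotal_or_0_def by blast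
  qed
qed

lemma pivotal_or_0_divide:
  assumes "pivotal_or_0 A" "pivotal B"
  shows "pivotal_or_0 (\<lambda>e. A e / B e)"
  using pivotal_or_0_mult[OF assms(1), of "\<lambda>e. inverse (B e)"] pivotal_inverse[OF assms(2)]
  by (simp add: pivotal_or_0_def divide_inverse)

lemma pivotal_or_0_sum:
  assumes "finite I" "\<And>i. i \<in> I \<Longrightarrow> pivotal_or_0 (A i)"
  shows "pivotal_or_0 (\<lambda>e. \<Sum>i\<in>I. A i e)"
  using assms
proof (induction I rule: finite_induct)
  case empty
  then show ?case by (simp add: pivotal_or_0_def)
next
  case (insert i I)
  then show ?case by (simp add: pivotal_or_0_add)
qed

lemma pivotal_of_pos:
  assumes "pivotal_or_0 A" "\<forall>\<^sub>F e in at_right 0. 0 < A e"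
  shows "pivotal A"
proof (rule ccontr)
  assume "\<not> pivotal A"
  then have "\<forall>\<^sub>F e in at_right 0. A e = 0" using assms(1) by (simp add: pivotal_or_0_def)
  with assms(2) have "\<forall>\<^sub>F e in at_right (0::real). False" by eventually_elim simp
  then show False by simp
qed

text \<open>The remainder is defined as the difference, so the equation holds for every e and no
  shrinking of the parameter interval occurs; only the smallness is asymptotic.\<close>

lemma pivotal_imp_expansion:
  assumes "pivotal A"
  shows "\<exists>h c rem. 0 < c \<and> (\<forall>e. A e = c * e powi h + rem e)
    \<and> ((\<lambda>e. rem e / e powi h) \<longlongrightarrow> 0) (at_right 0)"
proof -
  obtain h c where c: "0 < c" and A: "((\<lambda>e. A e / e powi h) \<longlongrightarrow> c) (at_right 0)"
    using assms unfolding pivotal_def by blast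
  have "((\<lambda>e. A e / e powi h - c) \<longlongrightarrow> c - c) (at_right 0)"
    by (intro tendsto_intros A)
  moreover have "\<forall>\<^sub>F e in at_right 0. A e / e powi h - c = (A e - c * e powi h) / e powi h"
    using eventually_pos_at_right by eventually_elim (simp add: diff_divide_distrib)
  ultimately have "((\<lambda>e. (A e - c * e powi h) / e powi h) \<longlongrightarrow> c - c) (at_right 0)"
    by (rule Lim_transform_eventually)
  with c show ?thesis
    by (intro exI[of _ h] exI[of _ c] exI[of _ "\<lambda>e. A e - c * e powi h"]) auto
qed

text \<open>For h < 0 a bounded function divided by \<open>e powi h\<close> tends to 0,
  contradicting the limit c > 0.\<close>

lemma pivotal_bounded_order_nonneg:
  fixes A rem :: "real \<Rightarrow> real"
  assumes c: "0 < c" and A: "\<And>e. A e = c * e powi h + rem e"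
    and rem: "((\<lambda>e. rem e / e powi h) \<longlongrightarrow> 0) (at_right 0)"
    and bounded: "\<forall>\<^sub>F e in at_right 0. \<bar>A e\<bar> \<le> C"
  shows "0 \<le> h"
proof (rule ccontr)
  assume "\<not> 0 \<le> h"
  have "((\<lambda>e. c + rem e / e powi h) \<longlongrightarrow> c + 0) (at_right 0)"
    by (intro tendsto_add tendsto_const rem)
  moreover have "\<forall>\<^sub>F e in at_right 0. c + rem e / e powi h = A e / e powi h"
    using eventually_pos_at_right by eventually_elim (simp add: A add_divide_distrib)
  ultimately have "((\<lambda>e. A e / e powi h) \<longlongrightarrow> c + 0) (at_right 0)"
    by (rule Lim_transform_eventually)
  then have 1: "((\<lambda>e. A e / e powi h) \<longlongrightarrow> c) (at_right 0)" by simp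
  have "((\<lambda>e::real. C * e powi (- h)) \<longlongrightarrow> C * (if - h = 0 then 1 else 0)) (at_right 0)"
    using \<open>\<not> 0 \<le> h\<close> by (intro tendsto_intros powi_tendsto) auto
  then have 2: "((\<lambda>e::real. C * e powi (- h)) \<longlongrightarrow> 0) (at_right 0)"
    using \<open>\<not> 0 \<le> h\<close> by simp
  have "\<forall>\<^sub>F e in at_right 0. norm (A e / e powi h) \<le> C * e powi (- h)"
    using bounded eventually_pos_at_right
  proof eventually_elim
    case (elim e)
    have "\<bar>A e\<bar> * e powi (- h) \<le> C * e powi (- h)"
      using elim by (intro mult_right_mono) auto
    then show ?case using elim by (simp add: power_int_minus divide_inverse abs_mult)
  qed
  from Lim_null_comparison[OF this 2] 1 have "c = 0"
    by (intro tendsto_unique[OF _ 1]) simp_all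
  with c show False by simp
qed

subsection \<open>Connectivity and expansions after the removal\<close>

text \<open>The path may visit \<open>r\<close>, where no reduced edge exists. The invariant
  therefore remembers the state a from which \<open>r\<close> was entered; loops at \<open>r\<close>
  keep it, and leaving \<open>r\<close> for c closes the edge from a to c in
  \<open>Yminus\<close>.\<close>

lemma removal_connected:
  assumes Y: "\<And>i. i \<in> X \<Longrightarrow> Y i \<subseteq> X" and i: "i \<in> X - {r}"
    and path: "(i, j) \<in> {(a, b). b \<in> Y a}\<^sup>+" 
  defines "E \<equiv> {(a, b). b \<in> Yminus X Y a r \<union> Yplus X Y a r}"
  shows "j \<in> X \<and> (if j = r then \<exists>a\<in>X - {r}. (i, a) \<in> E\<^sup>* \<and> r \<in> Y a else (i, j) \<in> E\<^sup>+)"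
  using path
proof (induction rule: trancl_induct)
  case (base b)
  then show ?case using Y i by (auto simp: E_def Yplus_def)
next
  case (step b c)
  from step have c: "c \<in> Y b" "c \<in> X" using Y by auto
  show ?case
  proof (cases "b = r")
    case True
    then obtain a where a: "a \<in> X - {r}" "(i, a) \<in> E\<^sup>*" "r \<in> Y a" using step by auto
    have "(i, c) \<in> E\<^sup>+" if "c \<noteq> r"
      using a c that True by (intro rtrancl_into_trancl1[OF a(2)]) (auto simp: E_def Yminus_def)
    then show ?thesis using a c by auto
  next
    case False
    then have b: "b \<in> X - {r}" "(i, b) \<in> E\<^sup>+" using step by auto
    have "(i, c) \<in> E\<^sup>+" if "c \<noteq> r"
      using b c that by (intro trancl_into_trancl[OF b(2)]) (auto simp: E_def Yplus_def)
    then show ?thesis using b c by (auto dest: trancl_into_rtrancl)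
  qed
qed

lemma path_iff_trancl:
  "(\<exists>n\<ge>1. \<exists>l::nat \<Rightarrow> nat. l 0 = i \<and> l n = j \<and> (\<forall>k<n. l (Suc k) \<in> Y (l k)))
     \<longleftrightarrow> (i, j) \<in> {(a, b). b \<in> Y a}\<^sup>+"
  by (auto simp: trancl_power relpow_fun_conv Suc_le_eq)

text \<open>Condition E is silent outside the transition sets; there the measure has mass zero, so
  its mean vanishes too.\<close>

lemma ke_eq_0:
  assumes "sm_kernel X K" "i \<in> X" "j \<in> X" "kp K i j = 0"
  shows "ke K i j = 0"
proof -
  interpret finite_measure "K i j" using assms by (auto simp: sm_kernel_def)
  have "sets (K i j) = sets borel" using assms by (auto simp: sm_kernel_def)
  then have "space (K i j) = UNIV" by (auto dest: sets_eq_imp_space_eq)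
  then have "emeasure (K i j) (space (K i j)) = 0"
    using assms(4) by (simp add: kp_def emeasure_eq_measure)
  then have "AE t in K i j. ennreal t = 0" by (intro AE_I[of _ _ "space (K i j)"]) auto
  then have "ke_ext K i j = (\<integral>\<^sup>+t. 0 \<partial>K i j)" unfolding ke_ext_def by (rule nn_integral_cong_AE)
  then show ?thesis by (simp add: ke_def)
qed

section \<open>Histories of positive probability\<close>

context markov_renewal
begin

text \<open>The initial distribution is unspecified, but countably many null events cannot cover the
  space.\<close>

lemma exists_positive_start: "\<exists>s\<in>X. 0 < measure M (cyl [s])"
proof (rule ccontr)
  assume "\<not> ?thesis"
  then have "measure M (cyl [s]) = 0" if "s \<in> X" for s
    using that by (auto simp: zero_less_measure_iff)
  then have "cyl [s] \<in> null_sets M" if "s \<in> X" for s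
    using that by (intro null_setsI) (simp_all add: emeasure_eq_measure)
  then have "AE \<omega> in M. s \<in> X \<longrightarrow> \<omega> \<notin> cyl [s]" for s
    using AE_not_in by (cases "s \<in> X") auto
  then have "AE \<omega> in M. \<forall>s. s \<in> X \<longrightarrow> \<omega> \<notin> cyl [s]"
    unfolding AE_all_countable by blast
  with AE_eta_in AE_space have "AE \<omega> in M. False"
    by eventually_elim (auto simp: cyl_def)
  then show False by simp
qed

lemma positive_path:
  assumes "\<And>a. a \<in> X \<Longrightarrow> Y a \<subseteq> X" "\<And>a b. a \<in> X \<Longrightarrow> b \<in> Y a \<Longrightarrow> 0 < kp Q a b"
    and "s \<in> X" "0 < measure M (cyl [s])" "(s, i) \<in> {(a, b). b \<in> Y a}\<^sup>+"
  shows "i \<in> X \<and> (\<exists>w. w \<noteq> [] \<and> last w = i \<and> 0 < measure M (cyl w))"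
  using assms(5)
proof (induction rule: trancl_induct)
  case (base b)
  then have "b \<in> Y s" by simp
  then have "b \<in> X" "0 < kp Q s b" using assms(1-3) by auto
  moreover from this have "0 < measure M (cyl ([s] @ [b]))"
    using assms(3,4) measure_cyl_snoc[of "[s]" b] by simp
  ultimately have "b \<in> X" "0 < measure M (cyl ([s] @ [b]))" by auto
  then show ?case by (metis append_is_Nil_conv last_snoc not_Cons_self2)
next
  case (step b c)
  then obtain w where w: "w \<noteq> []" "last w = b" "0 < measure M (cyl w)" and "b \<in> X" by blast
  have "c \<in> Y b" using step by simp
  then have "c \<in> X" "0 < kp Q b c" using assms(1,2) \<open>b \<in> X\<close> by auto
  moreover from this have "0 < measure M (cyl (w @ [c]))"
    using w \<open>b \<in> X\<close> measure_cyl_snoc[of w c] by simp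
  ultimately have "c \<in> X" "0 < measure M (cyl (w @ [c]))" by auto
  then show ?case by (metis append_is_Nil_conv last_snoc not_Cons_self2)
qed

end

section \<open>Transfer of the conditions to the reduced process\<close>

theorem theorem3:
  fixes N r :: nat and eps0 :: real and Y :: "nat \<Rightarrow> nat set"
    and Q rQ :: "real \<Rightarrow> nat \<Rightarrow> nat \<Rightarrow> real measure"
    and M :: "real \<Rightarrow> 'a measure"
    and eta :: "real \<Rightarrow> nat \<Rightarrow> 'a \<Rightarrow> nat" and kappa :: "real \<Rightarrow> nat \<Rightarrow> 'a \<Rightarrow> real"
  assumes eps0: "0 < eps0" "eps0 \<le> 1"
    and r: "r \<in> {1..N}"
    and kernel: "\<forall>eps\<in>{0<..1}. sm_kernel {1..N} (Q eps)"
    and process: "\<forall>eps\<in>{0<..1}. MRP {1..N} (M eps) (eta eps) (kappa eps) (Q eps)"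
    and init: "\<forall>eps\<in>{0<..1}. measure (M eps) {\<omega>\<in>space (M eps). eta eps 0 \<omega> = r} = 0"
    and conds: "condABCDE {1..N} Q eps0 Y"
    and rkernel: "\<forall>eps\<in>{0<..1}. sm_kernel ({1..N} - {r}) (rQ eps)"
    and rprocess: "\<forall>eps\<in>{0<..1}. MRP ({1..N} - {r}) (M eps)
                      (reta ({1..N} - {r}) (eta eps))
                      (rkappa ({1..N} - {r}) (eta eps) (kappa eps)) (rQ eps)"
  shows "condABCDE ({1..N} - {r}) rQ eps0
           (\<lambda>i. Yminus {1..N} Y i r \<union> Yplus {1..N} Y i r)"
proof -
  define X where "X = {1..N}"
  define rY where "rY = (\<lambda>i. Yminus X Y i r \<union> Yplus X Y i r)"
  have finX: "finite X" and r: "r \<in> X" using r by (auto simp: X_def)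
  have A: "condA X Q eps0 Y" and B: "condB X Q eps0" and C: "condC X Q eps0"
    and D: "condD X Q eps0 Y" and E: "condE X Q eps0 Y"
    using conds by (auto simp: condABCDE_def X_def)
  have Y: "Y i \<subseteq> X" if "i \<in> X" for i using A that by (auto simp: condA_def)
  have kp_pos: "0 < kp (Q e) i j" if "e \<in> {0<..eps0}" "i \<in> X" "j \<in> Y i" for e i j
    using A that Y unfolding condA_def by blast
  have kp_0: "kp (Q e) i j = 0" if "e \<in> {0<..eps0}" "i \<in> X" "j \<in> X" "j \<notin> Y i" for e i j
    using A that unfolding condA_def by blast
  have conn: "(i, j) \<in> {(a, b). b \<in> Y a}\<^sup>+" if "i \<in> X" "j \<in> X" for i j
    using A that unfolding condA_def path_iff_trancl by blast
  have near: "\<forall>\<^sub>F e in at_right 0. e \<in> {0<..eps0}"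
    using eps0 by (intro eventually_at_rightI[of 0 eps0]) auto
  have MR: "markov_renewal X (M e) (eta e) (kappa e) (Q e)" if "e \<in> {0<..eps0}" for e
    using that eps0 kernel process by unfold_locales (auto simp: X_def)
  \<comment> \<open>The state i only witnesses that something lies outside \<open>r\<close>: if
    \<open>r\<close> led nowhere else, no path from \<open>r\<close> to i could exist.\<close>
  have leave: "\<exists>j\<in>Y r. j \<noteq> r" if i: "i \<in> X - {r}" for i
  proof (rule ccontr)
    assume no: "\<not> ?thesis"
    have "(r, i) \<in> {(a, b). b \<in> Y a}\<^sup>+" using conn r i by blast
    then have "i = r" by (induction rule: trancl_induct) (use no in auto)
    with i show False by simp
  qed
  have krr: "1 - kp (Q e) r r = (\<Sum>j\<in>X - {r}. kp (Q e) r j)" if "e \<in> {0<..eps0}" for e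
    using markov_renewal.sum_kp[OF MR[OF that] r] sum.remove[OF finX r, of "kp (Q e) r"] by simp
  have krr_pos: "kp (Q e) r r < 1" if e: "e \<in> {0<..eps0}" and i: "i \<in> X - {r}" for e i
  proof -
    obtain j where j: "j \<in> Y r" "j \<noteq> r" using leave i by blast
    have "0 < (\<Sum>j\<in>X - {r}. kp (Q e) r j)"
      using finX kp_pos[OF e r j(1)] j Y[OF r]
      by (intro sum_pos2[of _ j]) (auto simp: kp_def)
    then show ?thesis using krr[OF e] by simp
  qed
  have red: "reduced_renewal X (M e) (eta e) (kappa e) (Q e) r (rQ e)"
    if e: "e \<in> {0<..eps0}" and i: "i \<in> X - {r}" for e i
  proof -
    interpret markov_renewal X "M e" "eta e" "kappa e" "Q e" using MR e .
    have e1: "e \<in> {0<..1}" using e eps0 by auto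
    have "{\<omega>\<in>space (M e). eta e 0 \<omega> = r} \<in> null_sets (M e)"
      using init e1 by (intro null_setsI) (auto simp: emeasure_eq_measure)
    then have start: "AE \<omega> in M e. eta e 0 \<omega> \<noteq> r"
      using AE_not_in AE_space by fastforce
    have "state_removal X (M e) (eta e) (kappa e) (Q e) r"
      using r krr_pos[OF e i] start B C e
      by unfold_locales (auto simp: condB_def condC_def)
    moreover have "markov_renewal (X - {r}) (M e) (reta (X - {r}) (eta e))
        (rkappa (X - {r}) (eta e) (kappa e)) (rQ e)"
      using rkernel rprocess e1 by unfold_locales (auto simp: X_def)
    ultimately show ?thesis by (rule reduced_renewal.intro)
  qed
  have reach: "\<exists>w. w \<noteq> [] \<and> last w = i \<and> 0 < measure (M e) (markov_renewal.cyl (M e) (eta e) w)"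
    if e: "e \<in> {0<..eps0}" and i: "i \<in> X - {r}" for e i
  proof -
    interpret markov_renewal X "M e" "eta e" "kappa e" "Q e" using MR e .
    obtain s where s: "s \<in> X" "0 < measure (M e) (cyl [s])" using exists_positive_start by blast
    have "(s, i) \<in> {(a, b). b \<in> Y a}\<^sup>+" using conn s i by blast
    from positive_path[OF Y kp_pos[OF e] s this] show ?thesis by blast
  qed
  have kp_red: "kp (rQ e) i j = kp (Q e) i j + kp (Q e) i r * kp (Q e) r j / (1 - kp (Q e) r r)"
    and kcdf_red: "kcdf (rQ e) i j 0 = 0"
    and ke_ext_red: "ke_ext (rQ e) i j = ennreal (ke (Q e) i j
     + (ke (Q e) i r * kp (Q e) r j + kp (Q e) i r * ke (Q e) r j) / (1 - kp (Q e) r r)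
     + kp (Q e) i r * ke (Q e) r r * kp (Q e) r j / (1 - kp (Q e) r r)\<^sup>2)"
    if e: "e \<in> {0<..eps0}" and ij: "i \<in> X - {r}" "j \<in> X - {r}" for e i j
  proof -
    interpret reduced_renewal X "M e" "eta e" "kappa e" "Q e" r "rQ e" using red e ij(1) .
    obtain w where w: "w \<noteq> []" "last w = i" "0 < measure (M e) (cyl w)" using reach[OF e ij(1)] by blast
    show "kp (rQ e) i j = kp (Q e) i j + kp (Q e) i r * kp (Q e) r j / (1 - kp (Q e) r r)"
      using kp_reduced[OF ij w] .
    show "kcdf (rQ e) i j 0 = 0" using kcdf_reduced_0[OF ij w] .
    show "ke_ext (rQ e) i j = ennreal (ke (Q e) i j
     + (ke (Q e) i r * kp (Q e) r j + kp (Q e) i r * ke (Q e) r j) / (1 - kp (Q e) r r)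
     + kp (Q e) i r * ke (Q e) r r * kp (Q e) r j / (1 - kp (Q e) r r)\<^sup>2)"
      using ke_ext_reduced[OF ij w] .
  qed
  have nn: "0 \<le> kp K i j" "0 \<le> ke K i j" for K i j by (simp_all add: kp_def ke_def)
  have ke_red: "ke (rQ e) i j = ke (Q e) i j
     + (ke (Q e) i r * kp (Q e) r j + kp (Q e) i r * ke (Q e) r j) / (1 - kp (Q e) r r)
     + kp (Q e) i r * ke (Q e) r r * kp (Q e) r j / (1 - kp (Q e) r r)\<^sup>2"
    if e: "e \<in> {0<..eps0}" and ij: "i \<in> X - {r}" "j \<in> X - {r}" for e i j
    unfolding ke_def[of "rQ e"] ke_ext_red[OF that] 
    using nn krr_pos[OF e ij(1)] by (intro enn2real_ennreal) simp
  have kp_red_pos: "0 < kp (rQ e) i j" if e: "e \<in> {0<..eps0}" and i: "i \<in> X - {r}" and j: "j \<in> rY i" for e i j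
  proof -
    have j': "j \<in> X - {r}" using j by (auto simp: rY_def Yminus_def Yplus_def split: if_splits)
    have d: "0 < 1 - kp (Q e) r r" using krr_pos[OF e i] by simp
    \<comment> \<open>The two ways of belonging to \<open>rY i\<close> match the two summands of the
      reduced probability.\<close>
    consider "j \<in> Y i" | "r \<in> Y i" "j \<in> Y r"
      using j by (auto simp: rY_def Yminus_def Yplus_def split: if_splits)
    then show ?thesis
    proof cases
      case 1
      have "0 < kp (Q e) i j" using kp_pos[OF e _ 1] i by blast
      then show ?thesis unfolding kp_red[OF e i j'] using nn d by (intro add_pos_nonneg) auto
    next
      case 2
      have "0 < kp (Q e) i r" "0 < kp (Q e) r j" using kp_pos[OF e] i r 2 by blast+
      then show ?thesis unfolding kp_red[OF e i j'] using nn d by (intro add_nonneg_pos) auto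
    qed
  qed
  have rA: "condA (X - {r}) rQ eps0 rY"
    unfolding condA_def path_iff_trancl
  proof (intro conjI ballI impI)
    show "rY i \<subseteq> X - {r}" for i by (auto simp: rY_def Yminus_def Yplus_def)
    show "0 < kp (rQ e) i j" if "e \<in> {0<..eps0}" "i \<in> X - {r}" "j \<in> rY i" for e i j
      using kp_red_pos that .
    show "kp (rQ e) i j = 0"
      if e: "e \<in> {0<..eps0}" and ij: "i \<in> X - {r}" "j \<in> X - {r}" and j: "j \<notin> rY i" for e i j
    proof -
      have "j \<notin> Y i" "r \<notin> Y i \<or> j \<notin> Y r"
        using j ij by (auto simp: rY_def Yminus_def Yplus_def)
      then show ?thesis unfolding kp_red[OF e ij] using kp_0[OF e] ij r by auto
    qed
    show "(i, j) \<in> {(a, b). b \<in> rY a}\<^sup>+" if "i \<in> X - {r}" "j \<in> X - {r}" for i j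
      using removal_connected[OF Y that(1) conn, of j] that by (auto simp: rY_def)
  qed
  have rB: "condB (X - {r}) rQ eps0"
    unfolding condB_def using kcdf_red by blast
  have rC: "condC (X - {r}) rQ eps0"
    unfolding condC_def using ke_ext_red by (simp del: Diff_iff)
  have piv_kp: "pivotal_or_0 (\<lambda>e. kp (Q e) i j)" if ij: "i \<in> X" "j \<in> X" for i j
  proof (cases "j \<in> Y i")
    case True
    then obtain lm lp :: nat and a rem where "lm \<le> lp" "0 < a lm"
        "\<forall>eps\<in>{0<..eps0}. kp (Q eps) i j = (\<Sum>l\<in>{lm..lp}. a l * eps ^ l) + rem eps"
        "((\<lambda>eps. rem eps / eps ^ lp) \<longlongrightarrow> 0) (at_right 0)"
      using D ij unfolding condD_def by blast
    then have "pivotal (\<lambda>e. kp (Q e) i j)"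
      using eps0 by (intro pivotal_expansion[where I="{lm..lp}" and f=int and b=a and rem=rem
          and ?l0.0=lm and m="int lp" and ?eps0.0=eps0]) auto
    then show ?thesis by (simp add: pivotal_or_0_def)
  next
    case False
    then have "\<forall>\<^sub>F e in at_right 0. kp (Q e) i j = 0"
      using kp_0 ij by (intro eventually_mono[OF near]) auto
    then show ?thesis by (simp add: pivotal_or_0_def)
  qed
  have piv_ke_Y: "pivotal (\<lambda>e. ke (Q e) i j)" if i: "i \<in> X" and j: "j \<in> Y i" for i j
  proof -
    obtain mm mp :: int and b rem where "mm \<le> mp" "0 < b mm"
        "\<forall>eps\<in>{0<..eps0}. ke (Q eps) i j = (\<Sum>l\<in>{mm..mp}. b l * eps powi l) + rem eps"
        "((\<lambda>eps. rem eps / eps powi mp) \<longlongrightarrow> 0) (at_right 0)"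
      using E i j unfolding condE_def by blast
    then show ?thesis
      using eps0 by (intro pivotal_expansion[where I="{mm..mp}" and f="\<lambda>l. l" and b=b and rem=rem
          and ?l0.0=mm and m=mp and ?eps0.0=eps0]) auto
  qed
  have piv_ke: "pivotal_or_0 (\<lambda>e. ke (Q e) i j)" if ij: "i \<in> X" "j \<in> X" for i j
  proof (cases "j \<in> Y i")
    case True
    then show ?thesis using piv_ke_Y ij by (simp add: pivotal_or_0_def)
  next
    case False
    have "\<forall>\<^sub>F e in at_right 0. ke (Q e) i j = 0"
      using near
    proof eventually_elim
      case (elim e)
      have "sm_kernel X (Q e)" using elim eps0 kernel by (auto simp: X_def)
      then show ?case using ke_eq_0 ij kp_0[OF elim ij False] by blast
    qed
    then show ?thesis by (simp add: pivotal_or_0_def)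
  qed
  have piv_d: "pivotal (\<lambda>e. 1 - kp (Q e) r r)" if i: "i \<in> X - {r}" for i
  proof (rule pivotal_cong)
    show "\<forall>\<^sub>F e in at_right 0. (\<Sum>j\<in>X - {r}. kp (Q e) r j) = 1 - kp (Q e) r r"
      using near by eventually_elim (simp add: krr)
    show "pivotal (\<lambda>e. \<Sum>j\<in>X - {r}. kp (Q e) r j)"
    proof (rule pivotal_of_pos)
      show "pivotal_or_0 (\<lambda>e. \<Sum>j\<in>X - {r}. kp (Q e) r j)"
        using finX r by (intro pivotal_or_0_sum piv_kp) auto
      show "\<forall>\<^sub>F e in at_right 0. 0 < (\<Sum>j\<in>X - {r}. kp (Q e) r j)"
        using near by eventually_elim (use krr_pos i in \<open>simp flip: krr\<close>)
    qed
  qed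
  have rY_X: "j \<in> X - {r}" if "j \<in> rY i" for i j
    using that by (auto simp: rY_def Yminus_def Yplus_def split: if_splits)
  have piv_rkp: "pivotal (\<lambda>e. kp (rQ e) i j)" if i: "i \<in> X - {r}" and j: "j \<in> rY i" for i j
  proof -
    have j': "j \<in> X - {r}" using rY_X j .
    let ?f = "\<lambda>e. kp (Q e) i j + kp (Q e) i r * kp (Q e) r j / (1 - kp (Q e) r r)"
    have eq: "\<forall>\<^sub>F e in at_right 0. ?f e = kp (rQ e) i j"
      using near by eventually_elim (use kp_red[OF _ i j'] in simp)
    have "pivotal_or_0 ?f"
      using i j' r by (intro pivotal_or_0_add pivotal_or_0_divide pivotal_or_0_mult piv_kp piv_d[OF i]) auto
    moreover have "\<forall>\<^sub>F e in at_right 0. 0 < ?f e"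
      using eq near by eventually_elim (use kp_red_pos i j in simp)
    ultimately have "pivotal ?f" by (rule pivotal_of_pos)
    then show ?thesis using eq by (rule pivotal_cong)
  qed
  have piv_rke: "pivotal (\<lambda>e. ke (rQ e) i j)" if i: "i \<in> X - {r}" and j: "j \<in> rY i" for i j
  proof -
    have j': "j \<in> X - {r}" using rY_X j .
    let ?t = "\<lambda>e. (ke (Q e) i r * kp (Q e) r j + kp (Q e) i r * ke (Q e) r j) / (1 - kp (Q e) r r)"
    let ?u = "\<lambda>e. kp (Q e) i r * ke (Q e) r r * kp (Q e) r j / (1 - kp (Q e) r r)\<^sup>2"
    let ?f = "\<lambda>e. ke (Q e) i j + ?t e + ?u e"
    have eq: "\<forall>\<^sub>F e in at_right 0. ?f e = ke (rQ e) i j"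
      using near by eventually_elim (use ke_red[OF _ i j'] in simp)
    have d2: "pivotal (\<lambda>e. (1 - kp (Q e) r r)\<^sup>2)"
      unfolding power2_eq_square by (intro pivotal_mult piv_d[OF i])
    have "pivotal_or_0 ?f"
      using i j' r by (intro pivotal_or_0_add pivotal_or_0_divide pivotal_or_0_mult
          piv_kp piv_ke piv_d[OF i] d2) auto
    moreover have "\<forall>\<^sub>F e in at_right 0. 0 < ?f e"
    proof -
      have u: "0 \<le> ?u e" for e using nn by simp
      consider "j \<in> Y i" | "r \<in> Y i" "j \<in> Y r"
        using j by (auto simp: rY_def Yminus_def Yplus_def split: if_splits)
      then show ?thesis
      proof cases
        case 1
        \<comment> \<open>Positivity is read off from the leading coefficient in E, hence for small
          e only, which is all that \<open>pivotal_of_pos\<close> asks.\<close>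
        have "\<forall>\<^sub>F e in at_right 0. 0 < ke (Q e) i j"
          using pivotal_eventually_pos[OF piv_ke_Y[OF _ 1]] i by blast
        with near show ?thesis
        proof eventually_elim
          case (elim e)
          have "0 \<le> ?t e" using nn krr_pos[OF elim(1) i] by simp
          then show ?case using elim u[of e] by linarith
        qed
      next
        case 2
        have "\<forall>\<^sub>F e in at_right 0. 0 < ke (Q e) i r"
          using pivotal_eventually_pos[OF piv_ke_Y[OF _ 2(1)]] i by blast
        with near show ?thesis
        proof eventually_elim
          case (elim e)
          have "0 < ?t e"
            using elim nn krr_pos[OF elim(1) i] kp_pos[OF elim(1) r 2(2)]
            by (intro divide_pos_pos add_pos_nonneg) auto
          then show ?case using nn(2)[of "Q e" i j] u[of e] by linarith
        qed
      qed
    qed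
    ultimately have "pivotal ?f" by (rule pivotal_of_pos)
    then show ?thesis using eq by (rule pivotal_cong)
  qed
  have rD: "condD (X - {r}) rQ eps0 rY"
    unfolding condD_def
  proof (intro ballI)
    fix i j assume i: "i \<in> X - {r}" and j: "j \<in> rY i"
    obtain h c rem where p: "0 < c" "\<forall>e. kp (rQ e) i j = c * e powi h + rem e"
      "((\<lambda>e. rem e / e powi h) \<longlongrightarrow> 0) (at_right 0)"
      using pivotal_imp_expansion[OF piv_rkp[OF i j]] by blast
    \<comment> \<open>Stochasticity of \<open>rQ\<close> provides the bound that forces a natural
      exponent.\<close>
    have "\<forall>\<^sub>F e in at_right 0. \<bar>kp (rQ e) i j\<bar> \<le> 1"
      using near
    proof eventually_elim
      case (elim e)
      have "(\<Sum>j\<in>X - {r}. kp (rQ e) i j) = 1"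
        using rkernel elim eps0 i by (auto simp: sm_kernel_def kp_def X_def)
      moreover have "kp (rQ e) i j \<le> (\<Sum>j\<in>X - {r}. kp (rQ e) i j)"
        using finX rY_X[OF j] nn by (intro member_le_sum) auto
      ultimately show ?case using nn(1) by simp
    qed
    then have "0 \<le> h" by (rule pivotal_bounded_order_nonneg[OF p(1) p(2)[rule_format] p(3)])
    then obtain n where "h = int n" using nonneg_int_cases by blast
    \<comment> \<open>With \<open>lm = lp = n\<close> only one coefficient is read, so a constant
      coefficient function serves.\<close>
    then show "\<exists>lm lp a rem. lm \<le> lp \<and> 0 < a lm \<and>
        (\<forall>eps\<in>{0<..eps0}. kp (rQ eps) i j = (\<Sum>l\<in>{lm..lp}. a l * eps ^ l) + rem eps) \<and>
        ((\<lambda>eps. rem eps / eps ^ lp) \<longlongrightarrow> 0) (at_right 0)"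
      using p by (intro exI[of _ n] exI[of _ "\<lambda>_. c"] exI[of _ rem]) simp
  qed
  have rE: "condE (X - {r}) rQ eps0 rY"
    unfolding condE_def
  proof (intro ballI)
    fix i j assume i: "i \<in> X - {r}" and j: "j \<in> rY i"
    obtain h c rem where p: "0 < c" "\<forall>e. ke (rQ e) i j = c * e powi h + rem e"
      "((\<lambda>e. rem e / e powi h) \<longlongrightarrow> 0) (at_right 0)"
      using pivotal_imp_expansion[OF piv_rke[OF i j]] by blast
    then show "\<exists>mm mp b rem. mm \<le> mp \<and> 0 < b mm \<and>
        (\<forall>eps\<in>{0<..eps0}. ke (rQ eps) i j = (\<Sum>l\<in>{mm..mp}. b l * eps powi l) + rem eps) \<and>
        ((\<lambda>eps. rem eps / eps powi mp) \<longlongrightarrow> 0) (at_right 0)"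
      by (intro exI[of _ h] exI[of _ "\<lambda>_. c"] exI[of _ rem]) simp
  qed
  show ?thesis
    using rA rB rC rD rE unfolding condABCDE_def rY_def X_def by (intro conjI)
qed

end
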